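(* Let $\lambda \vdash n$ be a partition with $f^\lambda \geq n^5 \geq 1$. Then for all $r \in \mathbb{Z}/n$, $$\left|\frac{a_{\lambda,r}}{f^\lambda} - \frac{1}{n}\right| < \frac{1}{n^2}.$$ In particular, if $n \geq 81$, $\lambda_1 < n-7$, and $\lambda_1' < n-7$, then $f^\lambda \geq n^5$ and the inequality above holds for all $r$.
   Context: $\lambda \vdash n$ means that $\lambda = (\lambda_1 \geq \lambda_2 \geq \cdots)$ is an integer partition of $n$; $\lambda'$ is the conjugate (transpose) partition, so $\lambda_1'$ is the number of nonzero parts of $\lambda$. A standard Young tableau of shape $\lambda \vdash n$ is a filling of the Young diagram of $\lambda$ with $1,\ldots,n$, each used once, increasing along rows and along columns going away from the corner cell; $\operatorname{SYT}(\lambda)$ is the set of these and $f^\lambda = \#\operatorname{SYT}(\lambda)$. A descent of $T$ is an $i \in \{1,\ldots,n-1\}$ such that $i+1$ lies in a row of strictly larger index than the row of $i$ (the $j$th row has $\lambda_j$ cells), and $\operatorname{maj} T$ is the sum of the descents of $T$. $a_{\lambda,r} = \#\{T \in \operatorname{SYT}(\lambda) : \operatorname{maj} T \equiv r \pmod n\}$. *)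

theory Defs
  imports Complex_Main "HOL-Library.FuncSet" "HOL-Number_Theory.Cong"
begin

text \<open>A partition is the list of its nonzero parts in weakly decreasing order.\<close>

definition partition_of :: "nat list \<Rightarrow> nat \<Rightarrow> bool" where
  "partition_of lam n \<longleftrightarrow> sorted_wrt (\<ge>) lam \<and> 0 \<notin> set lam \<and> sum_list lam = n"

definition nth_part :: "nat list \<Rightarrow> nat \<Rightarrow> nat" where
  "nth_part lam i = (if 1 \<le> i \<and> i \<le> length lam then lam ! (i - 1) else 0)"

text \<open>Cells are pairs \<open>(row, column)\<close>, both counted from \<open>1\<close>.\<close>

definition young_diagram :: "nat list \<Rightarrow> (nat \<times> nat) set" where
  "young_diagram lam = {(i, j). 1 \<le> i \<and> i \<le> length lam \<and> 1 \<le> j \<and> j \<le> nth_part lam i}"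

definition conjugate_partition :: "nat list \<Rightarrow> nat list" where
  "conjugate_partition lam = map (\<lambda>j. card {i. (i, j) \<in> young_diagram lam}) [1..<Suc (nth_part lam 1)]"

text \<open>
  Fillings are \<open>undefined\<close> off the diagram, so that each tableau is a single function
  and cardinalities of sets of functions count tableaux.
\<close>

definition SYT :: "nat list \<Rightarrow> (nat \<times> nat \<Rightarrow> nat) set" where
  "SYT lam = {T \<in> extensional (young_diagram lam).
     bij_betw T (young_diagram lam) {1..sum_list lam} \<and>
     (\<forall>i j j'. (i, j) \<in> young_diagram lam \<and> (i, j') \<in> young_diagram lam \<and> j < j' \<longrightarrow> T (i, j) < T (i, j')) \<and>
     (\<forall>i i' j. (i, j) \<in> young_diagram lam \<and> (i', j) \<in> young_diagram lam \<and> i < i' \<longrightarrow> T (i, j) < T (i', j))}"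

definition num_SYT :: "nat list \<Rightarrow> nat" where
  "num_SYT lam = card (SYT lam)"

definition row_of :: "nat list \<Rightarrow> (nat \<times> nat \<Rightarrow> nat) \<Rightarrow> nat \<Rightarrow> nat" where
  "row_of lam T k = fst (the_inv_into (young_diagram lam) T k)"

definition descents :: "nat list \<Rightarrow> (nat \<times> nat \<Rightarrow> nat) \<Rightarrow> nat set" where
  "descents lam T = {k \<in> {1..<sum_list lam}. row_of lam T k < row_of lam T (k + 1)}"

definition maj :: "nat list \<Rightarrow> (nat \<times> nat \<Rightarrow> nat) \<Rightarrow> nat" where
  "maj lam T = \<Sum>(descents lam T)"

text \<open>Residue classes modulo \<open>n\<close> are given by arbitrary integer representatives \<open>r\<close>.\<close>

definition num_SYT_maj :: "nat list \<Rightarrow> int \<Rightarrow> nat" where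
  "num_SYT_maj lam r = card {T \<in> SYT lam. [int (maj lam T) = r] (mod int (sum_list lam))}"

lemma finite_young_diagram: "finite (young_diagram lam)"
proof -
  have "young_diagram lam \<subseteq> (SIGMA i:{1..length lam}. {1..nth_part lam i})"
    by (auto simp: young_diagram_def)
  thus ?thesis by (rule finite_subset) auto
qed

lemma finite_SYT: "finite (SYT lam)"
proof -
  have "SYT lam \<subseteq> young_diagram lam \<rightarrow>\<^sub>E {1..sum_list lam}"
    unfolding SYT_def PiE_def Pi_def bij_betw_def by blast
  thus ?thesis by (rule finite_subset) (auto intro!: finite_PiE finite_young_diagram)
qed

lemma nth_part_conjugate_1:
  assumes "partition_of lam n"
  shows "nth_part (conjugate_partition lam) 1 = length lam"
proof (cases "lam = []")
  case False
  have pos: "0 < lam ! i" if "i < length lam" for i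
    using assms that nth_mem[OF that] unfolding partition_of_def by (metis gr0I)
  hence "nth_part lam 1 > 0" using False by (simp add: nth_part_def Suc_le_eq)
  moreover have "{i. (i, 1) \<in> young_diagram lam} = {1..length lam}"
    using pos by (auto simp: young_diagram_def nth_part_def Suc_le_eq)
  ultimately show ?thesis by (simp add: nth_part_def conjugate_partition_def del: upt_Suc)
qed (simp add: nth_part_def conjugate_partition_def)

end

theory Submission
  imports Defs "Jordan_Normal_Form.Determinant"
begin

text \<open>
  Write \<open>F(q)\<close> for the sum of \<open>q ^ maj T\<close> over the standard tableaux \<open>T\<close> of shape \<open>\<lambda>\<close>, so that
  \<open>F(1) = f\<^sup>\<lambda>\<close>. Extracting the residue class \<open>r\<close> by averaging over the \<open>n\<close>-th roots of unity shows
  that \<open>n * a\<^sub>\<lambda>\<^sub>,\<^sub>r - f\<^sup>\<lambda>\<close> is a sum of \<open>n - 1\<close> terms of absolute value \<open>\<bar>F(z)\<bar>\<close>, one for every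
  \<open>n\<close>-th root of unity \<open>z \<noteq> 1\<close>. Such a \<open>z\<close> has an order \<open>d \<ge> 2\<close> dividing \<open>n\<close>, and it suffices to prove
  \<open>\<bar>F(z)\<bar> \<le> f\<^sup>\<lambda> / n\<^sup>2\<close> (lemma \<open>norm_maj_sum_root_le\<close>).

  The value \<open>F(z)\<close> comes from the q-hook length formula
  \<open>F(q) * (\<Prod>h. 1 - q ^ h) = q ^ e * (\<Prod>m=1..n. 1 - q ^ m)\<close>, the first product being over the hook lengths
  of \<open>\<lambda>\<close>. A tableau is read as the word of the rows of its entries; appending letters one
  at a time gives a recurrence for the generating functions of \<open>maj\<close>, and Jacobi--Trudi determinants
  with some rows multiplied by powers of \<open>q\<close> satisfy the same recurrence just by linearity in one row
  (\<open>maj_sum_jt_det\<close>). The determinant is of Vandermonde type and hence a product, and in terms of the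
  beads \<open>\<lambda>\<^sub>i + k - 1 - i\<close> the hooks are the pairs of a bead and a smaller empty position
  (\<open>norm_maj_sum_hooks\<close>). Letting \<open>q\<close> tend to \<open>z\<close> radially compares orders of vanishing: \<open>F(z)\<close> is zero
  unless exactly \<open>s = n / d\<close> hooks are divisible by \<open>d\<close>, and then the remaining factors on
  both sides agree, so that \<open>\<bar>F(z)\<bar>\<close> is \<open>d ^ s * s!\<close> divided by the product of the hooks divisible by \<open>d\<close>.

  The inequality of Fomin and Lulov says that in this case the product of all hooks is at most the
  \<open>d\<close>-th power of the product of the hooks divisible by \<open>d\<close> (\<open>prod_hooks_le_prod_divisible\<close>). Give
  the multiples of \<open>d\<close> the weight \<open>d - 1\<close> and all other lengths the weight \<open>-1\<close>. The weights of the hooks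
  inside any window of consecutive positions have a sum \<open>\<le> 0\<close>: after arranging the beads of the
  window into runners modulo \<open>d\<close> and pushing them down, this says that \<open>N\<close> distinct natural numbers
  have a sum of at least \<open>0 + ... + (N - 1)\<close>. Summing over all windows of width \<open>w\<close> replaces the weight of
  a hook \<open>h\<close> by its multiple with \<open>max 0 (w - h)\<close>, and the logarithm, being concave, is a negative
  combination of these functions up to a constant. With \<open>f\<^sup>\<lambda> = n! / (\<Prod>h. h)\<close> one obtains
  \<open>\<bar>F(z)\<bar> ^ d \<le> (d ^ s * s!) ^ d / n! * f\<^sup>\<lambda> \<le> n ^ (d - 1) * f\<^sup>\<lambda>\<close>, and \<open>f\<^sup>\<lambda> \<ge> n ^ 5\<close> finishes the first part.

  For the second part call a shape of size \<open>n\<close> deep of level \<open>j\<close> if neither its first row nor its first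
  column has more than \<open>n - j\<close> cells. If \<open>1 \<le> j\<close> and \<open>2 * j + 2 \<le> n\<close>, a shape of level \<open>j\<close> that is not a rectangle
  can lose a cell in two ways such that one result has level \<open>j\<close> and the other has level \<open>j - 1\<close>. A
  rectangle of level 1 has in fact a level of at least \<open>n div 2\<close>, and it can lose two cells in two ways
  (\<open>num_words_branching\<close>). The resulting Pascal-like recurrence for lower bounds is evaluated up to
  \<open>n = 82\<close> and continued by polynomials in \<open>n\<close> (\<open>num_words_ge_power5\<close>).
\<close>

section \<open>Shapes and lattice words\<close>

text \<open>
  A shape is a weakly decreasing function on row indices, counted from 0. A corner is a row that can
  lose its last cell.
\<close>
definition corners :: "(nat \<Rightarrow> nat) \<Rightarrow> nat set" where
  "corners l = {r. l (Suc r) < l r}"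

text \<open>
  The newest letter comes first: the head of a word is the row of the largest entry of a tableau,
  and the recursion removes that entry.
\<close>
fun lattice_words :: "nat \<Rightarrow> (nat \<Rightarrow> nat) \<Rightarrow> nat list set" where
  "lattice_words 0 l = {[]}"
| "lattice_words (Suc n) l = (\<Union>r\<in>corners l. (#) r ` lattice_words n (l(r := l r - 1)))"

text \<open>
  With the newest letter first, the position of a letter is the length of the suffix that it starts.
\<close>
fun word_maj :: "nat list \<Rightarrow> nat" where
  "word_maj (r # s # w) = word_maj (s # w) + (if s < r then Suc (length w) else 0)"
| "word_maj _ = 0"

text \<open>
  The number \<open>k\<close> of rows is only an upper bound, because determinants and bead sets need a number of
  rows that can be chosen independently of the shape.
\<close>
definition bounded_shape :: "nat \<Rightarrow> nat \<Rightarrow> (nat \<Rightarrow> nat) \<Rightarrow> bool" where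
  "bounded_shape k n l \<longleftrightarrow> antimono l \<and> (\<forall>i\<ge>k. l i = 0) \<and> (\<Sum>i<k. l i) = n"

lemma corners_less: "bounded_shape k n l \<Longrightarrow> r \<in> corners l \<Longrightarrow> r < k"
  unfolding bounded_shape_def corners_def by (metis mem_Collect_eq not_less0 not_less)

lemma finite_corners: "bounded_shape k n l \<Longrightarrow> finite (corners l)"
  by (rule finite_subset[of _ "{..<k}"]) (auto dest: corners_less)

lemma bounded_shape_remove:
  assumes "bounded_shape k (Suc n) l" "r \<in> corners l"
  shows "bounded_shape k n (l(r := l r - 1))"
proof -
  have anti: "antimono l" and z: "\<forall>i\<ge>k. l i = 0" and s: "(\<Sum>i<k. l i) = Suc n"
    using assms(1) by (auto simp: bounded_shape_def)
  have r: "r < k" using corners_less assms by blast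
  have lr: "l (Suc r) < l r" using assms(2) by (simp add: corners_def)
  have "antimono (l(r := l r - 1))"
  proof (rule antimonoI)
    fix x y :: nat assume xy: "x \<le> y"
    show "(l(r := l r - 1)) y \<le> (l(r := l r - 1)) x"
    proof (cases "x = r \<and> y \<noteq> r")
      case True
      hence "l y \<le> l (Suc r)" using xy by (intro antimonoD[OF anti]) auto
      thus ?thesis using True lr by auto
    next
      case False
      thus ?thesis using antimonoD[OF anti xy] by auto
    qed
  qed
  moreover have "(\<Sum>i<k. (l(r := l r - 1)) i) = n"
  proof -
    have "(\<Sum>i<k. (l(r := l r - 1)) i) = (l r - 1) + (\<Sum>i\<in>{..<k}-{r}. l i)"
      using r by (subst sum.remove[of _ r]) auto
    moreover have "(\<Sum>i<k. l i) = l r + (\<Sum>i\<in>{..<k}-{r}. l i)"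
      using r by (subst sum.remove[of _ r]) auto
    ultimately show ?thesis using s lr by simp
  qed
  ultimately show ?thesis using z r by (auto simp: bounded_shape_def)
qed

lemma finite_lattice_words: "bounded_shape k n l \<Longrightarrow> finite (lattice_words n l)"
proof (induction n arbitrary: l)
  case (Suc n)
  show ?case unfolding lattice_words.simps
    by (intro finite_UN_I finite_imageI finite_corners[OF Suc.prems] Suc.IH bounded_shape_remove[OF Suc.prems])
qed simp

lemma length_lattice_words: "w \<in> lattice_words n l \<Longrightarrow> length w = n"
  by (induction n arbitrary: l w) auto

lemma sum_lattice_words_Suc:
  assumes "bounded_shape k (Suc n) l"
  shows "(\<Sum>w\<in>lattice_words (Suc n) l. f w) =
         (\<Sum>r\<in>corners l. \<Sum>w\<in>lattice_words n (l(r := l r - 1)). f (r # w))"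
proof -
  have "(\<Sum>w\<in>lattice_words (Suc n) l. f w) =
        (\<Sum>r\<in>corners l. \<Sum>w\<in>(#) r ` lattice_words n (l(r := l r - 1)). f w)"
    unfolding lattice_words.simps
    by (rule sum.UNION_disjoint)
       (use finite_lattice_words[OF bounded_shape_remove[OF assms]] in \<open>auto intro!: finite_corners[OF assms]\<close>)
  also have "\<dots> = (\<Sum>r\<in>corners l. \<Sum>w\<in>lattice_words n (l(r := l r - 1)). f (r # w))"
    by (rule sum.cong[OF refl]) (simp add: sum.reindex inj_on_def o_def)
  finally show ?thesis .
qed

section \<open>Standard Young tableaux as lattice words\<close>

definition parts_fun :: "nat list \<Rightarrow> nat \<Rightarrow> nat" where
  "parts_fun lam i = nth_part lam (Suc i)"

definition cells :: "(nat \<Rightarrow> nat) \<Rightarrow> (nat \<times> nat) set" where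
  "cells l = {(i, j). 1 \<le> i \<and> 1 \<le> j \<and> j \<le> l (i - 1)}"

definition tableaux :: "(nat \<times> nat) set \<Rightarrow> nat \<Rightarrow> (nat \<times> nat \<Rightarrow> nat) set" where
  "tableaux D n = {T \<in> extensional D. bij_betw T D {1..n} \<and>
     (\<forall>i j j'. (i, j) \<in> D \<and> (i, j') \<in> D \<and> j < j' \<longrightarrow> T (i, j) < T (i, j')) \<and>
     (\<forall>i i' j. (i, j) \<in> D \<and> (i', j) \<in> D \<and> i < i' \<longrightarrow> T (i, j) < T (i', j))}"

definition row_word :: "(nat \<times> nat) set \<Rightarrow> nat \<Rightarrow> (nat \<times> nat \<Rightarrow> nat) \<Rightarrow> nat list" where
  "row_word D n T = map (\<lambda>k. fst (the_inv_into D T k) - 1) (rev [1..<Suc n])"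

lemma cells_remove:
  "r \<in> corners l \<Longrightarrow> cells (l(r := l r - 1)) = cells l - {(Suc r, l r)}"
proof -
  assume r: "r \<in> corners l"
  have "(i, j) \<in> cells (l(r := l r - 1)) \<longleftrightarrow> (i, j) \<in> cells l - {(Suc r, l r)}" for i j
    using r by (cases i) (auto simp: cells_def corners_def)
  thus ?thesis by (simp add: set_eq_iff split_paired_all)
qed

text \<open>
  The largest entry sits at the end of its row and at the bottom of its column, hence in a corner, and
  it contributes the head of the row word.
\<close>
lemma tableau_remove_largest:
  assumes T: "T \<in> tableaux (cells l) (Suc n)"
  obtains r where "r \<in> corners l" "T (Suc r, l r) = Suc n"
    "restrict T (cells (l(r := l r - 1))) \<in> tableaux (cells (l(r := l r - 1))) n"
    "row_word (cells l) (Suc n) T = r # row_word (cells (l(r := l r - 1))) n (restrict T (cells (l(r := l r - 1))))"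
proof -
  have bij: "bij_betw T (cells l) {1..Suc n}"
    and row: "\<And>i j j'. (i, j) \<in> cells l \<Longrightarrow> (i, j') \<in> cells l \<Longrightarrow> j < j' \<Longrightarrow> T (i, j) < T (i, j')"
    and col: "\<And>i i' j. (i, j) \<in> cells l \<Longrightarrow> (i', j) \<in> cells l \<Longrightarrow> i < i' \<Longrightarrow> T (i, j) < T (i', j)"
    using T by (auto simp: tableaux_def)
  have inj: "inj_on T (cells l)" using bij by (simp add: bij_betw_def)
  have le: "T c \<le> Suc n" if "c \<in> cells l" for c using bij that by (auto simp: bij_betw_def)
  have "Suc n \<in> T ` cells l" using bij by (auto simp: bij_betw_def)
  then obtain i j where ij: "(i, j) \<in> cells l" "T (i, j) = Suc n" by auto
  define r where "r = i - 1"
  have i: "i = Suc r" using ij by (simp add: r_def cells_def)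
  have "j = l r"
  proof (rule ccontr)
    assume "j \<noteq> l r"
    hence "(i, Suc j) \<in> cells l" using ij i by (auto simp: cells_def)
    thus False using row[of i j "Suc j"] le[of "(i, Suc j)"] ij by simp
  qed
  note c = ij[unfolded i this]
  have r: "r \<in> corners l"
  proof (rule ccontr)
    assume "r \<notin> corners l"
    hence "(Suc (Suc r), l r) \<in> cells l" using c by (auto simp: cells_def corners_def)
    thus False using col[of "Suc r" "l r" "Suc (Suc r)"] le[of "(Suc (Suc r), l r)"] c by simp
  qed
  define D where "D = cells (l(r := l r - 1))"
  have D: "D = cells l - {(Suc r, l r)}" unfolding D_def by (rule cells_remove[OF r])
  have "bij_betw T D ({1..Suc n} - {T (Suc r, l r)})"
    unfolding D using bij by (rule bij_betw_DiffI) (use c in \<open>auto simp: bij_betw_def\<close>)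
  moreover have "{1..Suc n} - {T (Suc r, l r)} = {1..n}" using c by auto
  ultimately have "bij_betw T D {1..n}" by (simp only:)
  hence bij': "bij_betw (restrict T D) D {1..n}" by (simp cong: bij_betw_cong)
  hence T': "restrict T D \<in> tableaux D n"
    using row col by (auto simp: tableaux_def D)
  have eq: "the_inv_into (cells l) T k = the_inv_into D (restrict T D) k" if "k \<in> {1..n}" for k
  proof -
    have "k \<in> restrict T D ` D" using bij' that by (simp only: bij_betw_def)
    then obtain x where x: "x \<in> D" "restrict T D x = k" by blast
    hence "x \<in> cells l" "T x = k" by (auto simp: D)
    hence "the_inv_into (cells l) T k = x" using the_inv_into_f_f[OF inj] by blast
    moreover have "the_inv_into D (restrict T D) k = x"
      using the_inv_into_f_f[of "restrict T D" D x] bij' x by (simp add: bij_betw_def)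
    ultimately show ?thesis by simp
  qed
  have "the_inv_into (cells l) T (Suc n) = (Suc r, l r)"
    using the_inv_into_f_f[OF inj c(1)] c(2) by simp
  hence word: "row_word (cells l) (Suc n) T = r # row_word D n (restrict T D)"
    using eq by (auto simp: row_word_def)
  show ?thesis by (rule that[OF r c(2) T'[unfolded D_def] word[unfolded D_def]])
qed

lemma tableau_add_largest:
  assumes l: "antimono l" and r: "r \<in> corners l" and T: "T \<in> tableaux (cells (l(r := l r - 1))) n"
  shows "T((Suc r, l r) := Suc n) \<in> tableaux (cells l) (Suc n)"
proof -
  define c where "c = (Suc r, l r)"
  define D where "D = cells (l(r := l r - 1))"
  have "D = cells l - {c}" unfolding D_def c_def by (rule cells_remove[OF r])
  moreover have "c \<in> cells l" using r by (auto simp: c_def cells_def corners_def)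
  ultimately have D: "cells l = insert c D" "c \<notin> D" by auto
  have bij: "bij_betw T D {1..n}"
    and row: "\<And>i j j'. (i, j) \<in> D \<Longrightarrow> (i, j') \<in> D \<Longrightarrow> j < j' \<Longrightarrow> T (i, j) < T (i, j')"
    and col: "\<And>i i' j. (i, j) \<in> D \<Longrightarrow> (i', j) \<in> D \<Longrightarrow> i < i' \<Longrightarrow> T (i, j) < T (i', j)"
    and ext: "T \<in> extensional D"
    using T by (auto simp: tableaux_def D_def)
  have le: "T x \<le> n" if "x \<in> D" for x using bij that by (auto simp: bij_betw_def)
  define S where "S = T(c := Suc n)"
  have S: "S c = Suc n" "x \<in> D \<Longrightarrow> S x = T x" for x using D by (auto simp: S_def)
  have bij_D: "bij_betw S D {1..n}" using bij S by (simp cong: bij_betw_cong)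
  have "bij_betw S (D \<union> {c}) ({1..n} \<union> {S c})"
    by (rule notIn_Un_bij_betw[OF D(2) _ bij_D]) (simp add: S)
  moreover have "D \<union> {c} = cells l" "{1..n} \<union> {S c} = {1..Suc n}" using D(1) S(1) by auto
  ultimately have "bij_betw S (cells l) {1..Suc n}" by (simp only:)
  moreover have "S \<in> extensional (cells l)" using ext by (auto simp: extensional_def D S_def)
  moreover have "S (i, j) < S (i, j')" if "(i, j) \<in> cells l" "(i, j') \<in> cells l" "j < j'" for i j j'
  proof (cases "(i, j') = c")
    case True
    hence "(i, j) \<in> D" using that by (auto simp: D)
    thus ?thesis using True S le[of "(i, j)"] by simp
  next
    case False
    hence j': "(i, j') \<in> D" using that by (auto simp: D)
    have "(i, j) \<noteq> c"
    proof
      assume "(i, j) = c"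
      hence "j' \<le> l r" "j = l r" using that by (auto simp: c_def cells_def)
      thus False using that by simp
    qed
    hence "(i, j) \<in> D" using that by (auto simp: D)
    thus ?thesis using j' row that S by simp
  qed
  moreover have "S (i, j) < S (i', j)" if "(i, j) \<in> cells l" "(i', j) \<in> cells l" "i < i'" for i i' j
  proof (cases "(i', j) = c")
    case True
    hence "(i, j) \<in> D" using that by (auto simp: D)
    thus ?thesis using True S le[of "(i, j)"] by simp
  next
    case False
    hence i': "(i', j) \<in> D" using that by (auto simp: D)
    have "(i, j) \<noteq> c"
    proof
      assume "(i, j) = c"
      hence "l r \<le> l (i' - 1)" "Suc r \<le> i' - 1" using that by (auto simp: c_def cells_def)
      hence "l r \<le> l (Suc r)" using antimonoD[OF l] by (meson order_trans)
      thus False using r by (simp add: corners_def)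
    qed
    hence "(i, j) \<in> D" using that by (auto simp: D)
    thus ?thesis using i' col that S by simp
  qed
  ultimately show ?thesis by (auto simp: tableaux_def S_def c_def)
qed

text \<open>
  Removing the largest entry and prepending its row are mutually inverse, and the recursion for
  lattice words is exactly this removal.
\<close>
lemma bij_betw_row_word:
  assumes "bounded_shape k n l"
  shows "bij_betw (row_word (cells l) n) (tableaux (cells l) n) (lattice_words n l)"
  using assms
proof (induction n arbitrary: l)
  case 0
  have "l i = 0" for i using 0 by (cases "i < k") (auto simp: bounded_shape_def)
  hence c: "cells l = {}" by (auto simp: cells_def)
  have "tableaux {} 0 = {\<lambda>_. undefined}" by (auto simp: tableaux_def extensional_def bij_betw_def)
  thus ?case by (simp add: c row_word_def bij_betw_def inj_on_def)
next
  case (Suc n)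
  have anti: "antimono l" using Suc.prems by (simp add: bounded_shape_def)
  define rem where "rem r = l(r := l r - 1)" for r
  have IH: "bij_betw (row_word (cells (rem r)) n) (tableaux (cells (rem r)) n) (lattice_words n (rem r))"
    if "r \<in> corners l" for r
    unfolding rem_def using Suc.IH[OF bounded_shape_remove[OF Suc.prems that]] .
  have lw: "lattice_words (Suc n) l = (\<Union>r\<in>corners l. (#) r ` lattice_words n (rem r))"
    by (simp add: rem_def)
  have remove: "\<exists>r. r \<in> corners l \<and> T (Suc r, l r) = Suc n \<and>
      restrict T (cells (rem r)) \<in> tableaux (cells (rem r)) n \<and>
      row_word (cells l) (Suc n) T = r # row_word (cells (rem r)) n (restrict T (cells (rem r)))"
    if "T \<in> tableaux (cells l) (Suc n)" for T
    unfolding rem_def by (rule tableau_remove_largest[OF that]) blast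
  show ?case
  proof (rule bij_betw_imageI)
    show "inj_on (row_word (cells l) (Suc n)) (tableaux (cells l) (Suc n))"
    proof (rule inj_onI)
      fix T S assume TS: "T \<in> tableaux (cells l) (Suc n)" "S \<in> tableaux (cells l) (Suc n)"
        and eq: "row_word (cells l) (Suc n) T = row_word (cells l) (Suc n) S"
      from remove[OF TS(1)] obtain r where r: "r \<in> corners l" "T (Suc r, l r) = Suc n"
        "restrict T (cells (rem r)) \<in> tableaux (cells (rem r)) n"
        "row_word (cells l) (Suc n) T = r # row_word (cells (rem r)) n (restrict T (cells (rem r)))" by blast
      from remove[OF TS(2)] obtain s where s: "s \<in> corners l" "S (Suc s, l s) = Suc n"
        "restrict S (cells (rem s)) \<in> tableaux (cells (rem s)) n"
        "row_word (cells l) (Suc n) S = s # row_word (cells (rem s)) n (restrict S (cells (rem s)))" by blast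
      have sr: "s = r" using r s eq by simp
      hence "row_word (cells (rem r)) n (restrict T (cells (rem r))) = row_word (cells (rem r)) n (restrict S (cells (rem r)))"
        using r s eq by simp
      hence res: "restrict T (cells (rem r)) = restrict S (cells (rem r))"
        using IH[OF r(1)] r(3) s(3) sr by (auto simp: bij_betw_def dest: inj_onD)
      show "T = S"
      proof (rule extensionalityI)
        show "T \<in> extensional (cells l)" "S \<in> extensional (cells l)" using TS by (auto simp: tableaux_def)
        fix x assume "x \<in> cells l"
        hence "x = (Suc r, l r) \<or> x \<in> cells (rem r)" using cells_remove[OF r(1)] by (auto simp: rem_def)
        thus "T x = S x" using r(2) s(2) sr fun_cong[OF res, of x] by auto
      qed
    qed
    show "row_word (cells l) (Suc n) ` tableaux (cells l) (Suc n) = lattice_words (Suc n) l"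
    proof (intro equalityI subsetI)
      fix w assume "w \<in> row_word (cells l) (Suc n) ` tableaux (cells l) (Suc n)"
      then obtain T where T: "T \<in> tableaux (cells l) (Suc n)" "w = row_word (cells l) (Suc n) T" by blast
      from remove[OF T(1)] obtain r where r: "r \<in> corners l"
        "restrict T (cells (rem r)) \<in> tableaux (cells (rem r)) n"
        "w = r # row_word (cells (rem r)) n (restrict T (cells (rem r)))" using T(2) by blast
      have "row_word (cells (rem r)) n (restrict T (cells (rem r))) \<in> lattice_words n (rem r)"
        using IH[OF r(1)] r(2) by (auto simp: bij_betw_def)
      thus "w \<in> lattice_words (Suc n) l" unfolding lw using r by blast
    next
      fix w assume "w \<in> lattice_words (Suc n) l"
      then obtain r w' where r: "r \<in> corners l" "w' \<in> lattice_words n (rem r)" "w = r # w'"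
        unfolding lw by blast
      then obtain T where T: "T \<in> tableaux (cells (rem r)) n" "w' = row_word (cells (rem r)) n T"
        using IH[OF r(1)] by (auto simp: bij_betw_def)
      define S where "S = T((Suc r, l r) := Suc n)"
      have S: "S \<in> tableaux (cells l) (Suc n)"
        unfolding S_def using tableau_add_largest[OF anti r(1)] T(1) by (simp add: rem_def)
      from remove[OF S] obtain s where s: "s \<in> corners l" "S (Suc s, l s) = Suc n"
        "row_word (cells l) (Suc n) S = s # row_word (cells (rem s)) n (restrict S (cells (rem s)))" by blast
      have inj: "inj_on S (cells l)" using S by (auto simp: tableaux_def bij_betw_def)
      have cell: "(Suc t, l t) \<in> cells l" if "t \<in> corners l" for t
        using that by (auto simp: cells_def corners_def)
      have "(Suc s, l s) = (Suc r, l r)"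
        by (rule inj_onD[OF inj]) (use s cell r in \<open>auto simp: S_def\<close>)
      hence sr: "s = r" by simp
      have "restrict S (cells (rem r)) = T"
      proof (rule extensionalityI[of _ "cells (rem r)"])
        show "T \<in> extensional (cells (rem r))" using T by (auto simp: tableaux_def)
        fix x assume "x \<in> cells (rem r)"
        thus "restrict S (cells (rem r)) x = T x"
          using cells_remove[OF r(1)] by (auto simp: S_def rem_def)
      qed simp
      hence "row_word (cells l) (Suc n) S = w" using s sr T r by simp
      thus "w \<in> row_word (cells l) (Suc n) ` tableaux (cells l) (Suc n)" using S by blast
    qed
  qed
qed

lemma word_maj_map_upt:
  "word_maj (map g (rev [1..<Suc n])) = \<Sum>{k \<in> {1..<n}. g k < g (Suc k)}"
proof (induction n)
  case (Suc n)
  show ?case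
  proof (cases n)
    case (Suc m)
    have eq: "{k \<in> {1..<Suc n}. g k < g (Suc k)} =
       {k \<in> {1..<n}. g k < g (Suc k)} \<union> (if g n < g (Suc n) then {n} else {})"
      using Suc by (auto simp: less_Suc_eq)
    have "\<Sum>{k \<in> {1..<Suc n}. g k < g (Suc k)} = \<Sum>{k \<in> {1..<n}. g k < g (Suc k)} + (if g n < g (Suc n) then n else 0)"
      unfolding eq by (subst sum.union_disjoint) auto
    thus ?thesis using Suc.IH Suc by simp
  qed simp
qed simp

lemma young_diagram_cells: "young_diagram lam = cells (parts_fun lam)"
  by (auto simp: young_diagram_def cells_def parts_fun_def nth_part_def split: if_splits)

lemma bounded_shape_parts_fun:
  assumes "partition_of lam n"
  shows "bounded_shape (length lam) n (parts_fun lam)" "length lam \<le> n"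
proof -
  have "antimono (parts_fun lam)"
  proof (rule antimonoI)
    fix x y :: nat assume "x \<le> y"
    thus "parts_fun lam y \<le> parts_fun lam x"
      using assms sorted_wrt_nth_less[of "(\<ge>)" lam x y]
      by (cases "x = y") (auto simp: parts_fun_def nth_part_def partition_of_def)
  qed
  moreover have "(\<Sum>i<length lam. parts_fun lam i) = n"
    using assms by (simp add: parts_fun_def nth_part_def partition_of_def sum_list_sum_nth atLeast0LessThan)
  ultimately show "bounded_shape (length lam) n (parts_fun lam)"
    by (simp add: bounded_shape_def parts_fun_def nth_part_def)
  have "0 \<notin> set lam \<Longrightarrow> length lam \<le> sum_list lam" by (induction lam) auto
  thus "length lam \<le> n" using assms by (simp add: partition_of_def)
qed

lemma SYT_eq_tableaux:
  assumes "partition_of lam n"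
  shows "SYT lam = tableaux (cells (parts_fun lam)) n"
  using assms by (simp add: SYT_def tableaux_def young_diagram_cells partition_of_def)

text \<open>
  An entry \<open>k\<close> is a descent iff the letter of \<open>k + 1\<close> exceeds the letter of \<open>k\<close>.
\<close>
lemma maj_eq_word_maj:
  assumes lam: "partition_of lam n" and T: "T \<in> SYT lam"
  shows "maj lam T = word_maj (row_word (cells (parts_fun lam)) n T)"
proof -
  have bij: "bij_betw T (young_diagram lam) {1..n}"
    using T lam by (simp add: SYT_def partition_of_def)
  have pos: "row_of lam T k \<ge> 1" if "k \<in> {1..n}" for k
  proof -
    have "the_inv_into (young_diagram lam) T k \<in> young_diagram lam"
      using bij that by (intro the_inv_into_into) (auto simp: bij_betw_def)
    thus ?thesis by (cases "the_inv_into (young_diagram lam) T k") (auto simp: row_of_def young_diagram_def)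
  qed
  have "{k \<in> {1..<n}. row_of lam T k < row_of lam T (k + 1)} =
        {k \<in> {1..<n}. row_of lam T k - 1 < row_of lam T (Suc k) - 1}"
  proof (rule Collect_cong, rule conj_cong[OF refl])
    fix k assume "k \<in> {1..<n}"
    hence "row_of lam T k \<ge> 1" "row_of lam T (Suc k) \<ge> 1" using pos[of k] pos[of "Suc k"] by auto
    thus "row_of lam T k < row_of lam T (k + 1) \<longleftrightarrow> row_of lam T k - 1 < row_of lam T (Suc k) - 1" unfolding Suc_eq_plus1[symmetric] by arith
  qed
  thus ?thesis using lam
    unfolding maj_def descents_def row_word_def word_maj_map_upt young_diagram_cells[symmetric] row_of_def
    by (simp add: partition_of_def)
qed

lemma SYT_word_counts:
  assumes lam: "partition_of lam n"
  shows "num_SYT lam = card (lattice_words n (parts_fun lam))"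
    "num_SYT_maj lam r = card {w \<in> lattice_words n (parts_fun lam). [int (word_maj w) = r] (mod int n)}"
proof -
  define \<phi> where "\<phi> = row_word (cells (parts_fun lam)) n"
  have bij: "bij_betw \<phi> (SYT lam) (lattice_words n (parts_fun lam))"
    unfolding \<phi>_def SYT_eq_tableaux[OF lam] by (rule bij_betw_row_word[OF bounded_shape_parts_fun(1)[OF lam]])
  thus "num_SYT lam = card (lattice_words n (parts_fun lam))"
    unfolding num_SYT_def by (rule bij_betw_same_card)
  have "bij_betw \<phi> {T \<in> SYT lam. [int (maj lam T) = r] (mod int n)}
          {w \<in> lattice_words n (parts_fun lam). [int (word_maj w) = r] (mod int n)}"
  proof (rule bij_betw_subset[OF bij])
    show "\<phi> ` {T \<in> SYT lam. [int (maj lam T) = r] (mod int n)} =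
          {w \<in> lattice_words n (parts_fun lam). [int (word_maj w) = r] (mod int n)}"
    proof -
      have eq: "maj lam T = word_maj (\<phi> T)" if "T \<in> SYT lam" for T
        unfolding \<phi>_def by (rule maj_eq_word_maj[OF lam that])
      have im: "lattice_words n (parts_fun lam) = \<phi> ` SYT lam" using bij by (simp add: bij_betw_def)
      show ?thesis unfolding im by (auto simp: eq)
    qed
  qed auto
  from bij_betw_same_card[OF this] lam
  show "num_SYT_maj lam r = card {w \<in> lattice_words n (parts_fun lam). [int (word_maj w) = r] (mod int n)}"
    by (simp add: num_SYT_maj_def partition_of_def)
qed

section \<open>Determinants over Newton bases\<close>

text \<open>
  Determinants of functions instead of matrices, so that rows can be compared entrywise without
  dimension side conditions.
\<close>
definition det_of :: "nat \<Rightarrow> (nat \<Rightarrow> nat \<Rightarrow> 'a :: comm_ring_1) \<Rightarrow> 'a" where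
  "det_of k f = det (mat k k (\<lambda>(i, j). f i j))"

lemma det_of_leibniz:
  "det_of k f = (\<Sum>p | p permutes {0..<k}. signof p * (\<Prod>i=0..<k. f i (p i)))"
proof -
  have "det_of k f = (\<Sum>p | p permutes {0..<k}. signof p * (\<Prod>i=0..<k. mat k k (\<lambda>(i, j). f i j) $$ (i, p i)))"
    unfolding det_of_def by (rule det_def') simp
  also have "\<dots> = (\<Sum>p | p permutes {0..<k}. signof p * (\<Prod>i=0..<k. f i (p i)))"
  proof (intro sum.cong refl arg_cong2[of _ _ _ _ "(*)"] prod.cong)
    fix p i assume "p \<in> {p. p permutes {0..<k}}" "i \<in> {0..<k}"
    moreover from this have "p i \<in> {0..<k}" by (simp add: permutes_in_image)
    ultimately show "mat k k (\<lambda>(i, j). f i j) $$ (i, p i) = f i (p i)" by simp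
  qed
  finally show ?thesis .
qed

lemma det_of_cong: "(\<And>i j. i < k \<Longrightarrow> j < k \<Longrightarrow> f i j = g i j) \<Longrightarrow> det_of k f = det_of k g"
  unfolding det_of_def by (intro arg_cong[of _ _ det] cong_mat) auto

lemma det_of_row_add:
  assumes "r < k" "\<And>j. j < k \<Longrightarrow> f r j = g r j + h r j"
    and "\<And>i j. i < k \<Longrightarrow> j < k \<Longrightarrow> i \<noteq> r \<Longrightarrow> f i j = g i j"
    and "\<And>i j. i < k \<Longrightarrow> j < k \<Longrightarrow> i \<noteq> r \<Longrightarrow> f i j = h i j"
  shows "det_of k f = det_of k g + det_of k h"
  unfolding det_of_leibniz sum.distrib[symmetric]
proof (intro sum.cong refl)
  fix p assume "p \<in> {p. p permutes {0..<k}}"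
  hence pk: "p i < k" if "i < k" for i using that permutes_in_image[of p "{0..<k}" i] by simp
  have g: "(\<Prod>i\<in>{0..<k}-{r}. f i (p i)) = (\<Prod>i\<in>{0..<k}-{r}. g i (p i))"
    by (rule prod.cong) (auto simp: assms(3) pk)
  have h: "(\<Prod>i\<in>{0..<k}-{r}. f i (p i)) = (\<Prod>i\<in>{0..<k}-{r}. h i (p i))"
    by (rule prod.cong) (auto simp: assms(4) pk)
  have "(\<Prod>i=0..<k. F i (p i)) = F r (p r) * (\<Prod>i\<in>{0..<k}-{r}. F i (p i))" for F :: "nat \<Rightarrow> nat \<Rightarrow> 'a"
    using assms(1) by (subst prod.remove[of _ r]) auto
  from this[of f] this[of g] this[of h]
  show "signof p * (\<Prod>i=0..<k. f i (p i)) = signof p * (\<Prod>i=0..<k. g i (p i)) + signof p * (\<Prod>i=0..<k. h i (p i))"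
    by (simp add: assms(2)[OF pk[OF assms(1)]] g[symmetric] h[symmetric] algebra_simps)
qed

lemma det_of_scale:
  "det_of k (\<lambda>i j. a i * b j * f i j) = (\<Prod>i<k. a i) * (\<Prod>j<k. b j) * det_of k f"
  unfolding det_of_leibniz sum_distrib_left
proof (intro sum.cong refl)
  fix p assume "p \<in> {p. p permutes {0..<k}}"
  hence "(\<Prod>i=0..<k. b (p i)) = (\<Prod>i=0..<k. b i)"
    using prod.permute[of p "{0..<k}" b] by (simp add: o_def)
  thus "signof p * (\<Prod>i=0..<k. a i * b (p i) * f i (p i)) =
        (\<Prod>i<k. a i) * (\<Prod>j<k. b j) * (signof p * (\<Prod>i=0..<k. f i (p i)))"
    by (simp add: prod.distrib atLeast0LessThan algebra_simps)
qed

lemma det_of_zero_row: "r < k \<Longrightarrow> (\<And>j. j < k \<Longrightarrow> f r j = 0) \<Longrightarrow> det_of k f = 0"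
  using det_of_row_add[of r k f f f] by simp

lemma det_of_identical_rows:
  "i < k \<Longrightarrow> j < k \<Longrightarrow> i \<noteq> j \<Longrightarrow> (\<And>c. c < k \<Longrightarrow> f i c = f j c) \<Longrightarrow> det_of k f = 0"
  unfolding det_of_def by (rule det_identical_rows[of _ k i j]) (auto simp: row_def)

lemma det_of_upper_triangular:
  "(\<And>i j. i < k \<Longrightarrow> j < i \<Longrightarrow> f i j = 0) \<Longrightarrow> det_of k f = (\<Prod>i<k. f i i)"
  unfolding det_of_def
  by (subst det_upper_triangular[of _ k])
     (auto simp: upper_triangular_def diag_mat_def prod.distinct_set_conv_list[symmetric] atLeast0LessThan
           intro!: prod.cong simp flip: prod.list_conv_set_nth)

lemma det_of_lower_triangular:
  "(\<And>i j. i < j \<Longrightarrow> j < k \<Longrightarrow> f i j = 0) \<Longrightarrow> det_of k f = (\<Prod>i<k. f i i)"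
  unfolding det_of_def
  by (subst det_lower_triangular[of k])
     (auto simp: diag_mat_def prod.distinct_set_conv_list[symmetric] atLeast0LessThan)

lemma det_of_mult:
  "det_of k (\<lambda>i j. \<Sum>m<k. f i m * g m j) = det_of k f * det_of k g"
proof -
  have "mat k k (\<lambda>(i, j). \<Sum>m<k. f i m * g m j) = mat k k (\<lambda>(i, j). f i j) * mat k k (\<lambda>(i, j). g i j)"
    by (rule eq_matI) (auto simp: scalar_prod_def atLeast0LessThan intro!: sum.cong)
  thus ?thesis unfolding det_of_def by (simp add: det_mult[of _ k])
qed

text \<open>
  The coefficients of \<open>\<Prod>a<d. t - x a\<close> in the Newton basis \<open>\<Prod>a<m. t - z a\<close>; the recursion multiplies by
  \<open>t - x d = (t - z m) + (z m - x d)\<close>.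
\<close>
fun newton_coeff :: "(nat \<Rightarrow> 'a :: comm_ring_1) \<Rightarrow> (nat \<Rightarrow> 'a) \<Rightarrow> nat \<Rightarrow> nat \<Rightarrow> 'a" where
  "newton_coeff x z 0 m = (if m = 0 then 1 else 0)"
| "newton_coeff x z (Suc d) m =
     (if m = 0 then 0 else newton_coeff x z d (m - 1)) + (z m - x d) * newton_coeff x z d m"

lemma newton_coeff_gt: "d < m \<Longrightarrow> newton_coeff x z d m = 0"
  by (induction d arbitrary: m) auto

lemma newton_coeff_diag: "newton_coeff x z d d = 1"
  by (induction d) (auto simp: newton_coeff_gt)

lemma newton_expansion:
  "d < N \<Longrightarrow> (\<Prod>a<d. t - x a) = (\<Sum>m<N. newton_coeff x z d m * (\<Prod>a<m. t - z a))"
proof (induction d)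
  case 0
  have "(\<Sum>m<N. newton_coeff x z 0 m * (\<Prod>a<m. t - z a)) = (\<Sum>m\<in>{0}. newton_coeff x z 0 m * (\<Prod>a<m. t - z a))"
    using 0 by (intro sum.mono_neutral_right) auto
  thus ?case by simp
next
  case (Suc d)
  define P where "P m = (\<Prod>a<m. t - z a)" for m
  define c where "c m = newton_coeff x z d m" for m
  have P: "P (Suc m) = (t - z m) * P m" for m by (simp add: P_def mult.commute)
  obtain M where M: "N = Suc M" using Suc.prems by (cases N) auto
  have cM: "c M = 0" using Suc.prems M by (simp add: c_def newton_coeff_gt)
  have "(\<Prod>a<Suc d. t - x a) = (t - x d) * (\<Sum>m<N. c m * P m)"
    using Suc by (simp add: c_def P_def mult.commute)
  also have "\<dots> = (\<Sum>m<N. c m * P (Suc m)) + (\<Sum>m<N. (z m - x d) * c m * P m)"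
    unfolding sum_distrib_left sum.distrib[symmetric] by (intro sum.cong refl) (simp add: P algebra_simps)
  also have "(\<Sum>m<N. c m * P (Suc m)) = (\<Sum>m<N. (if m = 0 then 0 else c (m - 1)) * P m)"
    unfolding M by (subst (2) sum.lessThan_Suc_shift) (simp add: cM)
  also have "(\<Sum>m<N. (if m = 0 then 0 else c (m - 1)) * P m) + (\<Sum>m<N. (z m - x d) * c m * P m)
      = (\<Sum>m<N. newton_coeff x z (Suc d) m * P m)"
    unfolding sum.distrib[symmetric] by (intro sum.cong refl) (simp add: c_def algebra_simps)
  finally show ?case by (simp only: P_def)
qed

text \<open>
  A generalised Vandermonde determinant: the nodes \<open>x\<close> do not matter because changing
  them is a unitriangular change of basis. Taking the points \<open>y\<close> themselves as nodes makes the matrix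
  of values triangular, with the differences on the diagonal.
\<close>
lemma det_newton_products:
  fixes x y :: "nat \<Rightarrow> 'a :: comm_ring_1"
  shows "det_of k (\<lambda>i j. \<Prod>a<k - 1 - j. y i - x a) = (\<Prod>j<k. \<Prod>i\<in>{j<..<k}. y j - y i)"
proof -
  \<comment> \<open>The nodes in reverse order, because column \<open>j\<close> has degree \<open>k - 1 - j\<close>.\<close>
  define z where "z a = y (k - 1 - a)" for a
  have "det_of k (\<lambda>i j. \<Prod>a<k - 1 - j. y i - x a)
      = det_of k (\<lambda>i j. \<Sum>m<k. (\<Prod>a<k - 1 - m. y i - z a) * newton_coeff x z (k - 1 - j) (k - 1 - m))"
  proof (rule det_of_cong)
    fix i j assume "i < k" "j < k"
    hence "(\<Prod>a<k - 1 - j. y i - x a) = (\<Sum>m<k. newton_coeff x z (k - 1 - j) m * (\<Prod>a<m. y i - z a))"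
      by (intro newton_expansion) auto
    also have "\<dots> = (\<Sum>m<k. newton_coeff x z (k - 1 - j) (k - Suc m) * (\<Prod>a<k - Suc m. y i - z a))"
      by (rule sum.nat_diff_reindex[symmetric])
    finally show "(\<Prod>a<k - 1 - j. y i - x a) = (\<Sum>m<k. (\<Prod>a<k - 1 - m. y i - z a) * newton_coeff x z (k - 1 - j) (k - 1 - m))"
      by (simp add: mult.commute)
  qed
  also have "\<dots> = det_of k (\<lambda>i m. \<Prod>a<k - 1 - m. y i - z a)
                * det_of k (\<lambda>m j. newton_coeff x z (k - 1 - j) (k - 1 - m))"
    by (rule det_of_mult)
  also have "det_of k (\<lambda>m j. newton_coeff x z (k - 1 - j) (k - 1 - m)) = 1"
    by (subst det_of_lower_triangular) (auto intro!: newton_coeff_gt simp: newton_coeff_diag)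
  also have "det_of k (\<lambda>i m. \<Prod>a<k - 1 - m. y i - z a) = (\<Prod>j<k. \<Prod>a<k - 1 - j. y j - z a)"
  proof (rule det_of_upper_triangular)
    fix i j assume "i < k" "j < i"
    hence "k - 1 - i \<in> {..<k - 1 - j}" "y i - z (k - 1 - i) = 0" by (auto simp: z_def)
    thus "(\<Prod>a<k - 1 - j. y i - z a) = 0" by (meson finite_lessThan prod_zero)
  qed
  also have "\<dots> = (\<Prod>j<k. \<Prod>i\<in>{j<..<k}. y j - y i)"
  proof (rule prod.cong[OF refl])
    fix j assume "j \<in> {..<k}"
    thus "(\<Prod>a<k - 1 - j. y j - z a) = (\<Prod>i\<in>{j<..<k}. y j - y i)"
      by - (rule prod.reindex_bij_witness[where i = "\<lambda>i. k - 1 - i" and j = "\<lambda>a. k - 1 - a"], auto simp: z_def)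
  qed
  finally show ?thesis by simp
qed

section \<open>Jacobi--Trudi determinants and the major index\<close>

definition q_fact :: "complex \<Rightarrow> nat \<Rightarrow> complex" where
  "q_fact q n = (\<Prod>m=1..n. 1 - q ^ m)"

text \<open>
  The complete homogeneous symmetric function of degree \<open>m\<close> at \<open>1, q, q\<^sup>2, \<dots>\<close>.
\<close>
definition q_homog :: "complex \<Rightarrow> int \<Rightarrow> complex" where
  "q_homog q m = (if m < 0 then 0 else 1 / q_fact q (nat m))"

text \<open>
  The condition under which all denominators below are nonzero.
\<close>
definition non_root :: "complex \<Rightarrow> bool" where
  "non_root q \<longleftrightarrow> q \<noteq> 0 \<and> (\<forall>m>0. q ^ m \<noteq> 1)"

lemma q_fact_Suc: "q_fact q (Suc n) = q_fact q n * (1 - q ^ Suc n)"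
  by (simp add: q_fact_def)

lemma q_fact_0 [simp]: "q_fact q 0 = 1"
  by (simp add: q_fact_def)

lemma q_fact_nonzero: "non_root q \<Longrightarrow> q_fact q n \<noteq> 0"
  by (induction n) (auto simp: q_fact_Suc non_root_def simp del: power_Suc)

text \<open>
  Scaling the variables by \<open>q\<close> removes the variable 1, which is why the difference is again a
  complete homogeneous function, of degree one less.
\<close>
lemma q_homog_minus:
  assumes "non_root q"
  shows "q_homog q m - q powi m * q_homog q m = q_homog q (m - 1)"
proof (cases "m \<le> 0")
  case True
  thus ?thesis by (cases "m = 0") (auto simp: q_homog_def)
next
  case False
  define n where "n = nat (m - 1)"
  have m: "m = int (Suc n)" using False by (simp add: n_def)
  have nz: "q_fact q n \<noteq> 0" "1 - q ^ Suc n \<noteq> 0"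
    using assms q_fact_nonzero by (auto simp: non_root_def simp del: power_Suc)
  have "q powi m = q ^ Suc n" unfolding m by (rule power_int_of_nat)
  moreover have "nat (m - 1) = n" by (simp add: n_def)
  ultimately show ?thesis using nz
    by (simp add: m q_homog_def q_fact_Suc divide_simps del: power_Suc of_nat_Suc)
qed

text \<open>
  The Jacobi--Trudi determinant with the variables of the first \<open>r\<close> rows scaled by \<open>q\<close>. It interpolates between
  the determinant itself and its multiple by a power of \<open>q\<close>, and its steps follow
  the letters of lattice words.
\<close>
definition jt_det :: "complex \<Rightarrow> nat \<Rightarrow> nat \<Rightarrow> (nat \<Rightarrow> int) \<Rightarrow> complex" where
  "jt_det q k r l = det_of k (\<lambda>i j. (if i < r then q powi (l i - int i + int j) else 1)
                                  * q_homog q (l i - int i + int j))"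

text \<open>
  Linearity in row \<open>r\<close>: the unscaled minus the scaled row is the row of the shape with one cell less.
\<close>
lemma jt_det_remove:
  assumes "non_root q" "r < k"
  shows "jt_det q k r (l(r := l r - 1)) = jt_det q k r l - jt_det q k (Suc r) l"
proof -
  have "jt_det q k r l = jt_det q k (Suc r) l + jt_det q k r (l(r := l r - 1))"
    unfolding jt_det_def
  proof (rule det_of_row_add[of r])
    fix j
    show "(if r < r then q powi (l r - int r + int j) else 1) * q_homog q (l r - int r + int j) =
      (if r < Suc r then q powi (l r - int r + int j) else 1) * q_homog q (l r - int r + int j) +
      (if r < r then q powi ((l(r := l r - 1)) r - int r + int j) else 1) * q_homog q ((l(r := l r - 1)) r - int r + int j)"
      using q_homog_minus[OF assms(1), of "l r - int r + int j"] by (simp add: algebra_simps)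
  qed (use assms in auto)
  thus ?thesis by simp
qed

lemma jt_det_remove_equal_rows:
  assumes "Suc r < k" "l (Suc r) = l r"
  shows "jt_det q k r (l(r := l r - 1)) = 0"
  unfolding jt_det_def using assms by (intro det_of_identical_rows[of r k "Suc r"]) (auto simp: algebra_simps)

lemma jt_det_remove_empty_row:
  assumes "Suc r = k" "l r = 0"
  shows "jt_det q k r (l(r := l r - 1)) = 0"
  unfolding jt_det_def using assms by (intro det_of_zero_row[of r]) (auto simp: q_homog_def)

lemma jt_det_empty: "jt_det q k r (\<lambda>_. 0) = 1"
  unfolding jt_det_def by (subst det_of_upper_triangular) (auto simp: q_homog_def intro!: prod.neutral)

lemma jt_det_all_rows:
  assumes "q \<noteq> 0" "(\<Sum>i<k. l i) = int n"
  shows "jt_det q k k l = q ^ n * jt_det q k 0 l"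
proof -
  have "jt_det q k k l = det_of k (\<lambda>i j. q powi (l i - int i) * q powi (int j) * q_homog q (l i - int i + int j))"
    unfolding jt_det_def by (rule det_of_cong) (simp add: power_int_add assms)
  also have "\<dots> = (\<Prod>i<k. q powi (l i - int i)) * (\<Prod>j<k. q powi int j) * jt_det q k 0 l"
    by (simp add: det_of_scale jt_det_def)
  also have "(\<Prod>i<k. q powi (l i - int i)) * (\<Prod>j<k. q powi int j) = (\<Prod>i<k. q powi (l i))"
    unfolding prod.distrib[symmetric] by (intro prod.cong refl) (simp add: power_int_diff assms)
  also have "\<dots> = q powi (\<Sum>i<k. l i)"
    by (induction k) (simp_all add: power_int_add assms(1))
  finally show ?thesis by (simp add: assms)
qed

definition maj_sum :: "complex \<Rightarrow> nat \<Rightarrow> (nat \<Rightarrow> nat) \<Rightarrow> complex" where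
  "maj_sum q n l = (\<Sum>w\<in>lattice_words n l. q ^ word_maj w)"

text \<open>
  The major index here is that of the word with the letter \<open>r\<close> appended, which is what the
  recurrence on the last letter needs.
\<close>
definition maj_sum_followed_by :: "complex \<Rightarrow> nat \<Rightarrow> (nat \<Rightarrow> nat) \<Rightarrow> nat \<Rightarrow> complex" where
  "maj_sum_followed_by q n l r = (\<Sum>w\<in>lattice_words n l. q ^ word_maj (r # w))"

text \<open>
  Rows that are not corners may be included: there the determinant vanishes, because two rows agree or
  the last row is zero.
\<close>
lemma sum_corners_jt_det:
  assumes q: "non_root q" and l: "bounded_shape k (Suc n) l"
  shows "(\<Sum>r\<in>corners l. c r * jt_det q k r (int \<circ> l(r := l r - 1))) =
         (\<Sum>r<k. c r * (jt_det q k r (int \<circ> l) - jt_det q k (Suc r) (int \<circ> l)))"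
proof -
  have "(\<Sum>r\<in>corners l. c r * jt_det q k r (int \<circ> l(r := l r - 1))) =
        (\<Sum>r\<in>corners l. c r * jt_det q k r ((int \<circ> l)(r := int (l r) - 1)))"
    by (rule sum.cong[OF refl], rule arg_cong[of _ _ "\<lambda>x. _ * jt_det _ _ _ x"]) (auto simp: corners_def)
  also have "\<dots> = (\<Sum>r<k. c r * jt_det q k r ((int \<circ> l)(r := int (l r) - 1)))"
  proof (rule sum.mono_neutral_left)
    show "corners l \<subseteq> {..<k}" using corners_less[OF l] by auto
    show "\<forall>r\<in>{..<k} - corners l. c r * jt_det q k r ((int \<circ> l)(r := int (l r) - 1)) = 0"
    proof
      fix r assume r: "r \<in> {..<k} - corners l"
      hence eq: "l (Suc r) = l r"
        using l antimonoD[of l r "Suc r"] by (auto simp: corners_def bounded_shape_def)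
      show "c r * jt_det q k r ((int \<circ> l)(r := int (l r) - 1)) = 0"
      proof (cases "Suc r = k")
        case True
        hence "l r = 0" using l eq by (auto simp: bounded_shape_def)
        thus ?thesis using jt_det_remove_empty_row[OF True, of "int \<circ> l"] by simp
      next
        case False
        thus ?thesis using jt_det_remove_equal_rows[of r k "int \<circ> l" q] r eq by simp
      qed
    qed
  qed auto
  also have "\<dots> = (\<Sum>r<k. c r * (jt_det q k r (int \<circ> l) - jt_det q k (Suc r) (int \<circ> l)))"
    using jt_det_remove[OF q, of _ k "int \<circ> l"] by (intro sum.cong refl) simp
  finally show ?thesis .
qed

text \<open>
  Induction on the length for both sums at once. If the last letter is \<open>s\<close>, appending \<open>r\<close> creates a descent
  precisely when \<open>s < r\<close>, so the sum over \<open>s\<close> splits at \<open>r\<close> into two telescoping sums of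
  determinants, the first multiplied by \<open>q\<close> to the power of the length of the word.
\<close>
lemma maj_sum_jt_det:
  assumes q: "non_root q" and l: "bounded_shape k n l"
  shows "maj_sum q n l = q_fact q n * jt_det q k 0 (int \<circ> l)"
    and "\<And>r. r \<le> k \<Longrightarrow> maj_sum_followed_by q n l r = q_fact q n * jt_det q k r (int \<circ> l)"
proof -
  have "maj_sum q n l = q_fact q n * jt_det q k 0 (int \<circ> l) \<and>
        (\<forall>r\<le>k. maj_sum_followed_by q n l r = q_fact q n * jt_det q k r (int \<circ> l))"
    using l
  proof (induction n arbitrary: l)
    case 0
    have "l = (\<lambda>_. 0)"
    proof
      fix i show "l i = 0" using 0 by (cases "i < k") (auto simp: bounded_shape_def)
    qed
    thus ?case by (simp add: maj_sum_def maj_sum_followed_by_def jt_det_empty o_def)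
  next
    case (Suc n)
    note IH = conjunct2[OF Suc.IH[OF bounded_shape_remove[OF Suc.prems]]]
    define J where "J r = jt_det q k r (int \<circ> l)" for r
    have Jk: "J k = q ^ Suc n * J 0"
      unfolding J_def by (rule jt_det_all_rows) (use q Suc.prems in \<open>auto simp: non_root_def bounded_shape_def simp flip: of_nat_sum\<close>)
    have step: "(\<Sum>w\<in>lattice_words (Suc n) l. f w) = q_fact q n * (\<Sum>r<k. c r * (J r - J (Suc r)))"
      if "\<And>r w. w \<in> lattice_words n (l(r := l r - 1)) \<Longrightarrow> f (r # w) = c r * q ^ word_maj (r # w)" for f c
    proof -
      have "(\<Sum>w\<in>lattice_words (Suc n) l. f w) =
            (\<Sum>r\<in>corners l. c r * maj_sum_followed_by q n (l(r := l r - 1)) r)"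
        unfolding sum_lattice_words_Suc[OF Suc.prems] maj_sum_followed_by_def sum_distrib_left
        by (rule sum.cong[OF refl], rule sum.cong[OF refl], rule that)
      also have "\<dots> = (\<Sum>r\<in>corners l. q_fact q n * (c r * jt_det q k r (int \<circ> l(r := l r - 1))))"
      proof (rule sum.cong[OF refl])
        fix r assume r: "r \<in> corners l"
        have "r \<le> k" using corners_less[OF Suc.prems r] by simp
        hence "maj_sum_followed_by q n (l(r := l r - 1)) r = q_fact q n * jt_det q k r (int \<circ> l(r := l r - 1))"
          using IH[OF r] by blast
        thus "c r * maj_sum_followed_by q n (l(r := l r - 1)) r = q_fact q n * (c r * jt_det q k r (int \<circ> l(r := l r - 1)))"
          by (simp only: mult_ac)
      qed
      also have "\<dots> = q_fact q n * (\<Sum>r<k. c r * (J r - J (Suc r)))"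
        unfolding sum_distrib_left[symmetric] sum_corners_jt_det[OF q Suc.prems] J_def ..
      finally show ?thesis .
    qed
    have tele: "(\<Sum>r\<in>{a..<b}. J r - J (Suc r)) = J a - J b" if "a \<le> b" for a b
      using sum_Suc_diff'[OF that, of J] by (simp add: sum_subtractf algebra_simps)
    have all: "maj_sum q (Suc n) l = q_fact q n * (\<Sum>r<k. 1 * (J r - J (Suc r)))"
      unfolding maj_sum_def by (rule step) simp
    have 1: "maj_sum q (Suc n) l = q_fact q (Suc n) * J 0"
    proof -
      have "(\<Sum>r<k. 1 * (J r - J (Suc r))) = J 0 * (1 - q ^ Suc n)"
        using tele[of 0 k] unfolding Jk by (simp add: atLeast0LessThan algebra_simps)
      with all show ?thesis by (simp only: q_fact_Suc mult_ac)
    qed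
    have 2: "maj_sum_followed_by q (Suc n) l r = q_fact q (Suc n) * J r" if "r \<le> k" for r
    proof -
      have "maj_sum_followed_by q (Suc n) l r =
            q_fact q n * (\<Sum>s<k. (if s < r then q ^ Suc n else 1) * (J s - J (Suc s)))"
        unfolding maj_sum_followed_by_def
        by (rule step) (auto dest!: length_lattice_words simp: power_add)
      also have "(\<Sum>s<k. (if s < r then q ^ Suc n else 1) * (J s - J (Suc s))) =
            (\<Sum>s\<in>{0..<r}. (if s < r then q ^ Suc n else 1) * (J s - J (Suc s))) +
            (\<Sum>s\<in>{r..<k}. (if s < r then q ^ Suc n else 1) * (J s - J (Suc s)))"
        using that by (subst sum.atLeastLessThan_concat) (simp_all add: atLeast0LessThan)
      also have "\<dots> = q ^ Suc n * (J 0 - J r) + (J r - J k)"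
        using tele[of 0 r] tele[of r k] that by (simp flip: sum_distrib_left)
      finally show ?thesis by (simp add: Jk q_fact_Suc algebra_simps)
    qed
    show ?case using 1 2 unfolding J_def by blast
  qed
  thus "maj_sum q n l = q_fact q n * jt_det q k 0 (int \<circ> l)"
    "\<And>r. r \<le> k \<Longrightarrow> maj_sum_followed_by q n l r = q_fact q n * jt_det q k r (int \<circ> l)" by auto
qed

section \<open>Beads and hooks\<close>

text \<open>
  The differences \<open>b - x\<close> of these pairs are the hook lengths of the shape with bead set \<open>B\<close>. Working with
  pairs avoids arms and legs.
\<close>
definition hook_pairs :: "nat set \<Rightarrow> (nat \<times> nat) set" where
  "hook_pairs B = (SIGMA b:B. {..<b} - B)"

definition bead_pairs :: "nat set \<Rightarrow> (nat \<times> nat) set" where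
  "bead_pairs B = (SIGMA b:B. {..<b} \<inter> B)"

definition beads :: "nat \<Rightarrow> (nat \<Rightarrow> nat) \<Rightarrow> nat set" where
  "beads k l = (\<lambda>i. l i + (k - 1 - i)) ` {..<k}"

lemma finite_hook_pairs: "finite B \<Longrightarrow> finite (hook_pairs B)"
  and finite_bead_pairs: "finite B \<Longrightarrow> finite (bead_pairs B)"
  by (auto simp: hook_pairs_def bead_pairs_def)

lemma finite_beads [simp]: "finite (beads k l)"
  by (simp add: beads_def)

lemma prod_hook_pairs:
  fixes f :: "nat \<Rightarrow> nat \<Rightarrow> 'a :: comm_monoid_mult"
  assumes "finite B"
  shows "(\<Prod>b\<in>B. \<Prod>x<b. f b x) = (\<Prod>(b, x)\<in>hook_pairs B. f b x) * (\<Prod>(b, x)\<in>bead_pairs B. f b x)"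
proof -
  have "(\<Prod>b\<in>B. \<Prod>x<b. f b x) = (\<Prod>b\<in>B. (\<Prod>x\<in>{..<b} - B. f b x) * (\<Prod>x\<in>{..<b} \<inter> B. f b x))"
    by (intro prod.cong refl) (metis finite_lessThan mult.commute prod.Int_Diff)
  thus ?thesis using assms by (simp add: hook_pairs_def bead_pairs_def prod.distrib prod.Sigma)
qed

lemma sum_hook_pairs:
  fixes f :: "nat \<Rightarrow> nat \<Rightarrow> 'a :: comm_monoid_add"
  assumes "finite B"
  shows "(\<Sum>b\<in>B. \<Sum>x<b. f b x) = (\<Sum>(b, x)\<in>hook_pairs B. f b x) + (\<Sum>(b, x)\<in>bead_pairs B. f b x)"
proof -
  have "(\<Sum>b\<in>B. \<Sum>x<b. f b x) = (\<Sum>b\<in>B. (\<Sum>x\<in>{..<b} - B. f b x) + (\<Sum>x\<in>{..<b} \<inter> B. f b x))"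
    by (intro sum.cong refl) (metis finite_lessThan add.commute sum.Int_Diff)
  thus ?thesis using assms by (simp add: hook_pairs_def bead_pairs_def sum.distrib sum.Sigma)
qed

lemma bead_less:
  assumes "antimono (l :: nat \<Rightarrow> nat)" "i < j" "j < k"
  shows "l j + (k - 1 - j) < l i + (k - 1 - i)"
  using antimonoD[OF assms(1), of i j] assms by simp

lemma inj_on_bead:
  assumes "antimono (l :: nat \<Rightarrow> nat)"
  shows "inj_on (\<lambda>i. l i + (k - 1 - i)) {..<k}"
  by (rule inj_onI) (metis assms bead_less lessThan_iff linorder_neqE_nat nat_less_le)

lemma card_beads: "antimono l \<Longrightarrow> card (beads k l) = k"
  unfolding beads_def by (subst card_image[OF inj_on_bead]) auto

lemma prod_bead_pairs_beads:
  fixes f :: "nat \<Rightarrow> nat \<Rightarrow> 'a :: comm_monoid_mult"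
  assumes "antimono l"
  shows "(\<Prod>(b, x)\<in>bead_pairs (beads k l). f b x) =
         (\<Prod>j<k. \<Prod>i\<in>{j<..<k}. f (l j + (k - 1 - j)) (l i + (k - 1 - i)))"
proof -
  define b where "b i = l i + (k - 1 - i)" for i
  have bl: "b j < b i" if "i < j" "j < k" for i j
    using bead_less[OF assms that] by (simp add: b_def)
  have B: "beads k l = b ` {..<k}" by (simp add: beads_def b_def)
  have inj: "inj_on b {..<k}" unfolding b_def by (rule inj_on_bead[OF assms])
  have "(\<Prod>(x, y)\<in>bead_pairs (beads k l). f x y) = (\<Prod>(j, i)\<in>(SIGMA j:{..<k}. {j<..<k}). f (b j) (b i))"
  proof (rule prod.reindex_cong[of "map_prod b b"])
    show "inj_on (map_prod b b) (SIGMA j:{..<k}. {j<..<k})"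
      using inj by (auto simp: inj_on_def)
    show "bead_pairs (beads k l) = map_prod b b ` (SIGMA j:{..<k}. {j<..<k})"
    proof (intro equalityI subsetI)
      fix z assume "z \<in> bead_pairs (beads k l)"
      then obtain j i where z: "z = (b j, b i)" "j < k" "i < k" "b i < b j"
        by (auto simp: bead_pairs_def B)
      have "j < i" using bl[of i j] z by (metis linorder_neqE_nat not_less_iff_gr_or_eq)
      thus "z \<in> map_prod b b ` (SIGMA j:{..<k}. {j<..<k})" using z by force
    next
      fix z assume "z \<in> map_prod b b ` (SIGMA j:{..<k}. {j<..<k})"
      thus "z \<in> bead_pairs (beads k l)" using bl by (auto simp: bead_pairs_def B)
    qed
  qed auto
  thus ?thesis unfolding b_def by (simp only: prod.Sigma[OF finite_lessThan ballI[OF finite_greaterThanLessThan]])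
qed

text \<open>
  After multiplication by \<open>q_fact q b\<close> the entries are polynomials in \<open>q ^ b\<close> whose degree does not depend
  on the row; for \<open>b < c\<close> both sides vanish.
\<close>
lemma q_homog_shift:
  assumes "non_root q"
  shows "q_homog q (int b - int c) * q_fact q b = (\<Prod>m<c. - (1 / q ^ m)) * (\<Prod>m<c. q ^ b - q ^ m)"
proof (induction c)
  case 0
  thus ?case using q_fact_nonzero[OF assms] by (simp add: q_homog_def)
next
  case (Suc c)
  have q0: "q \<noteq> 0" using assms by (simp add: non_root_def)
  have "q_homog q (int b - int (Suc c)) = q_homog q (int b - int c) * (1 - q powi (int b - int c))"
    using q_homog_minus[OF assms, of "int b - int c"] by (simp add: algebra_simps)
  also have "1 - q powi (int b - int c) = - (1 / q ^ c) * (q ^ b - q ^ c)"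
    using q0 by (simp add: power_int_diff field_simps)
  finally have "q_homog q (int b - int (Suc c)) * q_fact q b =
      q_homog q (int b - int c) * q_fact q b * (- (1 / q ^ c) * (q ^ b - q ^ c))"
    by (simp only: mult_ac)
  thus ?case unfolding Suc.IH by (simp add: mult_ac)
qed

lemma jt_det_beads:
  assumes q: "non_root q" and l: "antimono l"
  shows "norm (jt_det q k 0 (int \<circ> l)) * (\<Prod>b\<in>beads k l. norm (q_fact q b)) * norm q ^ (\<Sum>j<k. \<Sum>m<k - 1 - j. m)
       = (\<Prod>(b, x)\<in>bead_pairs (beads k l). norm (q ^ b - q ^ x))"
proof -
  define b where "b i = l i + (k - 1 - i)" for i
  have q0: "q \<noteq> 0" using q by (simp add: non_root_def)
  have nz: "q_fact q m \<noteq> 0" for m by (rule q_fact_nonzero[OF q])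
  have "jt_det q k 0 (int \<circ> l) = det_of k (\<lambda>i j. (1 / q_fact q (b i)) * (\<Prod>m<k - 1 - j. - (1 / q ^ m)) * (\<Prod>m<k - 1 - j. q ^ b i - q ^ m))"
    unfolding jt_det_def
  proof (rule det_of_cong)
    fix i j assume ij: "i < k" "j < k"
    have "(int \<circ> l) i - int i + int j = int (b i) - int (k - 1 - j)" using ij by (simp add: b_def)
    hence eq: "q_homog q ((int \<circ> l) i - int i + int j) * q_fact q (b i) = (\<Prod>m<k - 1 - j. - (1 / q ^ m)) * (\<Prod>m<k - 1 - j. q ^ b i - q ^ m)"
      using q_homog_shift[OF q, of "b i" "k - 1 - j"] by (simp only:)
    show "(if i < 0 then q powi ((int \<circ> l) i - int i + int j) else 1) * q_homog q ((int \<circ> l) i - int i + int j) =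
       (1 / q_fact q (b i)) * (\<Prod>m<k - 1 - j. - (1 / q ^ m)) * (\<Prod>m<k - 1 - j. q ^ b i - q ^ m)"
      using nz[of "b i"] unfolding mult.assoc eq[symmetric] by simp
  qed
  also have "\<dots> = (\<Prod>i<k. 1 / q_fact q (b i)) * (\<Prod>j<k. \<Prod>m<k - 1 - j. - (1 / q ^ m)) *
                  (\<Prod>j<k. \<Prod>i\<in>{j<..<k}. q ^ b j - q ^ b i)"
    using det_newton_products[of k "\<lambda>i. q ^ b i" "\<lambda>m. q ^ m"] by (simp only: det_of_scale)
  finally have eq: "norm (jt_det q k 0 (int \<circ> l)) = (\<Prod>i<k. 1 / norm (q_fact q (b i))) * (\<Prod>j<k. \<Prod>m<k - 1 - j. 1 / norm q ^ m) *
                  (\<Prod>j<k. \<Prod>i\<in>{j<..<k}. norm (q ^ b j - q ^ b i))"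
    by (simp add: norm_mult norm_divide norm_power flip: prod_norm)
  have 1: "(\<Prod>b\<in>beads k l. norm (q_fact q b)) * (\<Prod>i<k. 1 / norm (q_fact q (b i))) = 1"
    unfolding beads_def prod.reindex[OF inj_on_bead[OF l]] prod.distrib[symmetric]
    using nz by (simp add: b_def)
  have 2: "(\<Prod>j<k. \<Prod>m<k - 1 - j. 1 / norm q ^ m) * norm q ^ (\<Sum>j<k. \<Sum>m<k - 1 - j. m) = 1"
    unfolding power_sum prod.distrib[symmetric] using q0 by simp
  have "norm (jt_det q k 0 (int \<circ> l)) * (\<Prod>b\<in>beads k l. norm (q_fact q b)) * norm q ^ (\<Sum>j<k. \<Sum>m<k - 1 - j. m) =
     ((\<Prod>b\<in>beads k l. norm (q_fact q b)) * (\<Prod>i<k. 1 / norm (q_fact q (b i)))) *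
     ((\<Prod>j<k. \<Prod>m<k - 1 - j. 1 / norm q ^ m) * norm q ^ (\<Sum>j<k. \<Sum>m<k - 1 - j. m)) *
     (\<Prod>j<k. \<Prod>i\<in>{j<..<k}. norm (q ^ b j - q ^ b i))"
    unfolding eq by (simp only: mult_ac)
  thus ?thesis unfolding 1 2 prod_bead_pairs_beads[OF l] by (simp add: b_def)
qed

text \<open>
  The q-hook length formula up to a power of \<open>q\<close>. The factor \<open>q_fact q b\<close> of a bead \<open>b\<close> runs over all smaller
  positions; those occupied by beads cancel against the Vandermonde product, and the empty
  ones are the hooks.
\<close>
lemma norm_maj_sum_hooks:
  assumes q: "non_root q" and l: "bounded_shape k n l"
  shows "norm (maj_sum q n l) * norm q ^ (\<Sum>j<k. \<Sum>m<k - 1 - j. m) *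
           (\<Prod>(b, x)\<in>hook_pairs (beads k l). norm (1 - q ^ (b - x)))
       = norm (q_fact q n) * norm q ^ (\<Sum>(b, x)\<in>bead_pairs (beads k l). x)"
proof -
  define B where "B = beads k l"
  define S where "S = (\<Prod>(b, x)\<in>bead_pairs B. norm (1 - q ^ (b - x)))"
  define H where "H = (\<Prod>(b, x)\<in>hook_pairs B. norm (1 - q ^ (b - x)))"
  define e where "e = (\<Sum>j<k. \<Sum>m<k - 1 - j. m)"
  have anti: "antimono l" using l by (simp add: bounded_shape_def)
  have fin: "finite B" by (simp add: B_def)
  have S: "S \<noteq> 0"
    using q unfolding S_def by (subst prod_zero_iff[OF finite_bead_pairs[OF fin]]) (auto simp: bead_pairs_def non_root_def)
  have "q_fact q b = (\<Prod>x<b. 1 - q ^ (b - x))" for b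
    unfolding q_fact_def
    by (rule prod.reindex_bij_witness[where i = "\<lambda>x. b - x" and j = "\<lambda>m. b - m"]) auto
  hence "(\<Prod>b\<in>B. norm (q_fact q b)) = (\<Prod>b\<in>B. \<Prod>x<b. norm (1 - q ^ (b - x)))"
    by (simp add: prod_norm)
  also have "\<dots> = H * S" unfolding H_def S_def by (rule prod_hook_pairs[OF fin])
  finally have 1: "(\<Prod>b\<in>B. norm (q_fact q b)) = H * S" .
  have "(\<Prod>(b, x)\<in>bead_pairs B. norm (q ^ b - q ^ x)) = (\<Prod>(b, x)\<in>bead_pairs B. norm q ^ x * norm (1 - q ^ (b - x)))"
  proof (rule prod.cong[OF refl], clarify)
    fix b x assume "(b, x) \<in> bead_pairs B"
    hence "x \<le> b" by (auto simp: bead_pairs_def)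
    hence "q ^ x - q ^ b = q ^ x * (1 - q ^ (b - x))" by (simp add: right_diff_distrib flip: power_add)
    thus "norm (q ^ b - q ^ x) = norm q ^ x * norm (1 - q ^ (b - x))"
      by (metis norm_minus_commute norm_mult norm_power)
  qed
  also have "\<dots> = norm q ^ (\<Sum>(b, x)\<in>bead_pairs B. x) * S"
    by (simp add: S_def prod.distrib power_sum case_prod_unfold)
  finally have 2: "(\<Prod>(b, x)\<in>bead_pairs B. norm (q ^ b - q ^ x)) = norm q ^ (\<Sum>(b, x)\<in>bead_pairs B. x) * S" .
  have "norm (jt_det q k 0 (int \<circ> l)) * (H * S) * norm q ^ e = norm q ^ (\<Sum>(b, x)\<in>bead_pairs B. x) * S"
    using jt_det_beads[OF q anti, of k] 1 2 by (simp add: B_def e_def)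
  hence "(norm (jt_det q k 0 (int \<circ> l)) * norm q ^ e * H) * S = norm q ^ (\<Sum>(b, x)\<in>bead_pairs B. x) * S"
    by (simp add: mult_ac)
  hence key: "norm q ^ (\<Sum>(b, x)\<in>bead_pairs B. x) = norm (jt_det q k 0 (int \<circ> l)) * norm q ^ e * H"
    using S by simp
  show ?thesis
    unfolding maj_sum_jt_det(1)[OF q l] norm_mult B_def[symmetric] H_def[symmetric] e_def[symmetric] key
    by (simp only: mult_ac)
qed

section \<open>Hooks in windows\<close>

text \<open>
  This weight has sum 0 over any \<open>l\<close> consecutive lengths. Its sum over the hooks of a shape compares the
  number of all hooks with \<open>l\<close> times the number of hooks divisible by \<open>l\<close>.
\<close>
definition balance :: "nat \<Rightarrow> nat \<Rightarrow> int" where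
  "balance l d = (if l dvd d then int l - 1 else - 1)"

definition runner :: "nat \<Rightarrow> nat \<Rightarrow> nat set \<Rightarrow> nat set" where
  "runner l r A = {b\<in>A. b mod l = r}"

text \<open>
  The beads pushed down as far as possible within their residue classes: the bead set of the
  \<open>l\<close>-core.
\<close>
definition packed_runners :: "nat \<Rightarrow> nat set \<Rightarrow> nat set" where
  "packed_runners l A = (\<Union>r<l. (\<lambda>m. l * m + r) ` {..<card (runner l r A)})"

lemma sum_initial_le_sum:
  fixes S :: "nat set"
  assumes "finite S"
  shows "\<Sum>{..<card S} \<le> \<Sum>S" "\<Sum>{..<card S} = \<Sum>S \<Longrightarrow> S = {..<card S}"
proof -
  have "\<Sum>{..<card S} \<le> \<Sum>S \<and> (\<Sum>{..<card S} = \<Sum>S \<longrightarrow> S = {..<card S})"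
    using assms
  proof (induction S rule: finite_linorder_max_induct)
    case (insert b A)
    have bA: "b \<notin> A" using insert by auto
    have "A \<subseteq> {..<b}" using insert by auto
    hence cb: "card A \<le> b" using card_mono[of "{..<b}" A] by simp
    have c: "card (insert b A) = Suc (card A)" using insert bA by simp
    have s: "\<Sum>(insert b A) = b + \<Sum>A" using insert bA by simp
    show ?case
    proof (intro conjI impI)
      show "\<Sum>{..<card (insert b A)} \<le> \<Sum>(insert b A)" using cb insert.IH by (simp add: c s)
      assume "\<Sum>{..<card (insert b A)} = \<Sum>(insert b A)"
      hence "b = card A" "\<Sum>{..<card A} = \<Sum>A" using cb insert.IH by (simp_all add: c s)
      thus "insert b A = {..<card (insert b A)}"
        using insert.IH unfolding c lessThan_Suc by simp
    qed
  qed simp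
  thus "\<Sum>{..<card S} \<le> \<Sum>S" "\<Sum>{..<card S} = \<Sum>S \<Longrightarrow> S = {..<card S}" by auto
qed

lemma card_bead_pairs: "finite A \<Longrightarrow> card (bead_pairs A) = \<Sum>{..<card A}"
proof (induction A rule: finite_linorder_max_induct)
  case empty
  thus ?case by (simp add: bead_pairs_def)
next
  case (insert b A)
  have bA: "b \<notin> A" using insert by auto
  have "bead_pairs (insert b A) = {b} \<times> A \<union> bead_pairs A"
    using insert by (auto simp: bead_pairs_def)
  moreover have "({b} \<times> A) \<inter> bead_pairs A = {}" using bA by (auto simp: bead_pairs_def)
  ultimately have "card (bead_pairs (insert b A)) = card A + card (bead_pairs A)"
    using insert by (simp add: card_Un_disjoint finite_bead_pairs card_cartesian_product)
  thus ?case using insert bA by simp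
qed

lemma sum_balance_initial:
  assumes "l > 0"
  shows "(\<Sum>x<b. balance l (b - x)) = - int (b mod l)"
proof -
  have "(\<Sum>x<b. balance l (b - x)) = (\<Sum>d=1..b. balance l d)"
    by (rule sum.reindex_bij_witness[where i = "\<lambda>d. b - d" and j = "\<lambda>x. b - x"]) auto
  also have "\<dots> = - int (b mod l)"
  proof (induction b)
    case (Suc b)
    have "balance l (Suc b) = int (b mod l) - int (Suc b mod l)"
      using assms by (auto simp: balance_def mod_Suc dvd_eq_mod_eq_0)
    thus ?case using Suc by simp
  qed simp
  finally show ?thesis .
qed

lemma finite_runner [simp]: "finite A \<Longrightarrow> finite (runner l r A)"
  by (simp add: runner_def)

lemma packed_runners_facts:
  assumes "l > 0" "finite A"
  shows "finite (packed_runners l A)" "card (packed_runners l A) = card A"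
    "\<Sum>(packed_runners l A) = (\<Sum>r<l. l * \<Sum>{..<card (runner l r A)} + r * card (runner l r A))"
proof -
  have disj: "(\<lambda>m. l * m + r) ` X \<inter> (\<lambda>m. l * m + s) ` Y = {}" if "r < l" "s < l" "r \<noteq> s" for r s and X Y :: "nat set"
  proof -
    have "(l * m + r) mod l = r" "(l * m + s) mod l = s" for m using that by auto
    thus ?thesis using that(3) by (metis (no_types, lifting) disjoint_iff imageE)
  qed
  have inj: "inj_on (\<lambda>m. l * m + r) X" for r X using assms(1) by (auto simp: inj_on_def)
  show "finite (packed_runners l A)" by (simp add: packed_runners_def)
  have "card (packed_runners l A) = (\<Sum>r<l. card (runner l r A))"
    unfolding packed_runners_def using disj inj
    by (subst card_UN_disjoint) (auto simp: card_image)
  also have "\<dots> = card (\<Union>r<l. runner l r A)"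
    using assms by (subst card_UN_disjoint) (auto simp: runner_def)
  also have "(\<Union>r<l. runner l r A) = A" using assms(1) by (auto simp: runner_def)
  finally show "card (packed_runners l A) = card A" .
  have "\<Sum>(packed_runners l A) = (\<Sum>r<l. \<Sum>((\<lambda>m. l * m + r) ` {..<card (runner l r A)}))"
    unfolding packed_runners_def using disj by (subst sum.UNION_disjoint) auto
  also have "\<dots> = (\<Sum>r<l. l * \<Sum>{..<card (runner l r A)} + r * card (runner l r A))"
    by (intro sum.cong refl) (simp add: sum.reindex[OF inj] sum.distrib sum_distrib_left)
  finally show "\<Sum>(packed_runners l A) = (\<Sum>r<l. l * \<Sum>{..<card (runner l r A)} + r * card (runner l r A))" .
qed

text \<open>
  The pairs of a bead with an arbitrary smaller position contribute minus the residue of the bead. Subtracting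
  the pairs of two beads, counted in total and within each runner, leaves the two sums of initial segments.
\<close>
lemma sum_balance_hook_pairs:
  assumes "l > 0" "finite A"
  shows "(\<Sum>(b, x)\<in>hook_pairs A. balance l (b - x)) = int (\<Sum>{..<card A}) - int (\<Sum>(packed_runners l A))"
proof -
  let ?N = "\<lambda>r. card (runner l r A)"
  have A: "A = (\<Union>r<l. runner l r A)" using assms(1) by (auto simp: runner_def)
  have "(\<Sum>b\<in>A. int (b mod l)) = (\<Sum>b\<in>(\<Union>r<l. runner l r A). int (b mod l))" using A by simp
  also have "\<dots> = (\<Sum>r<l. \<Sum>b\<in>runner l r A. int (b mod l))"
    using assms by (subst sum.UNION_disjoint) (auto simp: runner_def)
  also have "\<dots> = (\<Sum>r<l. int (r * ?N r))"
    by (intro sum.cong refl) (simp add: runner_def)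
  finally have 1: "(\<Sum>b\<in>A. int (b mod l)) = (\<Sum>r<l. int (r * ?N r))" .
  have div: "{z \<in> bead_pairs A. l dvd fst z - snd z} = (\<Union>r<l. bead_pairs (runner l r A))"
  proof -
    have "l dvd b - x \<longleftrightarrow> x mod l = b mod l" if "x < b" for b x
      using mod_eq_dvd_iff_nat[of x b l] that by auto
    thus ?thesis using assms(1) by (auto simp: bead_pairs_def runner_def)
  qed
  have "(\<Sum>(b, x)\<in>bead_pairs A. balance l (b - x)) =
        (\<Sum>z\<in>bead_pairs A. (if l dvd fst z - snd z then int l else 0) - 1)"
    by (intro sum.cong refl) (auto simp: balance_def)
  also have "\<dots> = int l * int (card {z \<in> bead_pairs A. l dvd fst z - snd z}) - int (card (bead_pairs A))"
    using finite_bead_pairs[OF assms(2)] by (simp add: sum_subtractf sum.If_cases Int_def)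
  also have "card {z \<in> bead_pairs A. l dvd fst z - snd z} = (\<Sum>r<l. card (bead_pairs (runner l r A)))"
    unfolding div using assms
    by (subst card_UN_disjoint) (auto simp: finite_bead_pairs bead_pairs_def runner_def)
  also have "\<dots> = (\<Sum>r<l. \<Sum>{..<?N r})" using assms by (simp add: card_bead_pairs)
  finally have 2: "(\<Sum>(b, x)\<in>bead_pairs A. balance l (b - x)) =
     int l * int (\<Sum>r<l. \<Sum>{..<?N r}) - int (\<Sum>{..<card A})"
    using card_bead_pairs[OF assms(2)] by simp
  have "(\<Sum>b\<in>A. \<Sum>x<b. balance l (b - x)) = - (\<Sum>r<l. int (r * ?N r))"
    unfolding sum_balance_initial[OF assms(1)] sum_negf 1 ..
  thus ?thesis using sum_hook_pairs[OF assms(2), of "\<lambda>b x. balance l (b - x)"] 2 packed_runners_facts(3)[OF assms]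
    by (simp add: sum.distrib sum_distrib_left)
qed

lemma sum_balance_hook_pairs_nonpos:
  assumes "l > 0" "finite A"
  shows "(\<Sum>(b, x)\<in>hook_pairs A. balance l (b - x)) \<le> 0"
  using sum_balance_hook_pairs[OF assms] sum_initial_le_sum(1)[OF packed_runners_facts(1)[OF assms]] packed_runners_facts(2)[OF assms]
  by (simp del: of_nat_sum)

text \<open>
  Equality in the minimal sum forces the packed beads to form an initial segment, so all runners
  are equally full.
\<close>
lemma card_runner_if_balanced:
  assumes "l > 0" "finite A" "(\<Sum>(b, x)\<in>hook_pairs A. balance l (b - x)) = 0"
    and "card A = l * t" "r < l"
  shows "card (runner l r A) = t"
proof -
  have "\<Sum>{..<card (packed_runners l A)} = \<Sum>(packed_runners l A)"
    using sum_balance_hook_pairs[OF assms(1,2)] assms(3) packed_runners_facts(2)[OF assms(1,2)] by (simp del: of_nat_sum)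
  hence P: "packed_runners l A = {..<l * t}"
    using sum_initial_le_sum(2)[OF packed_runners_facts(1)[OF assms(1,2)]] packed_runners_facts(2)[OF assms(1,2)] assms(4) by metis
  have "m < card (runner l r A) \<longleftrightarrow> m < t" for m
  proof -
    have "m < card (runner l r A) \<longleftrightarrow> l * m + r \<in> packed_runners l A"
    proof
      assume "l * m + r \<in> packed_runners l A"
      then obtain s m' where s: "s < l" "m' < card (runner l s A)" "l * m + r = l * m' + s"
        by (auto simp: packed_runners_def)
      have "(l * m + r) mod l = r" using assms(5) by simp
      moreover have "(l * m' + s) mod l = s" using s(1) by simp
      ultimately have "s = r" using s(3) by simp
      hence "m = m'" using s assms(1) by simp
      thus "m < card (runner l r A)" using s \<open>s = r\<close> by simp
    qed (use assms(5) in \<open>auto simp: packed_runners_def\<close>)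
    also have "\<dots> \<longleftrightarrow> l * m + r < l * t" by (simp add: P)
    also have "\<dots> \<longleftrightarrow> m < t"
    proof
      assume "m < t"
      hence "l * Suc m \<le> l * t" by (intro mult_le_mono2) simp
      thus "l * m + r < l * t" using assms(5) by simp
    next
      assume "l * m + r < l * t"
      hence "l * m < l * t" by linarith
      thus "m < t" by simp
    qed
    finally show ?thesis .
  qed
  thus ?thesis by (metis linorder_neqE_nat nat_less_le)
qed

text \<open>
  A hook of length \<open>h\<close> lies in \<open>w - h\<close> windows of width \<open>w\<close>, or in none if \<open>h > w\<close>. Hence the sum is
  the total over all windows of sums as in \<open>sum_balance_hook_pairs_nonpos\<close>.
  The beads below \<open>w\<close> guarantee that no window is cut off at 0.
\<close>
lemma sum_balance_window_nonpos:
  assumes l: "l > 0" and B: "finite B" "{..<w} \<subseteq> B"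
  shows "(\<Sum>(b, x)\<in>hook_pairs B. balance l (b - x) * int (w - (b - x))) \<le> 0"
proof -
  define Z where "Z = Suc (Max B)"
  have less_Z: "b < Z" if "b \<in> B" for b using B that by (simp add: Z_def less_Suc_eq_le)
  define win where "win z = (\<lambda>b. b - z) ` (B \<inter> {z..<z + w})" for z
  have win_iff: "y \<in> win z \<longleftrightarrow> y + z \<in> B \<and> y < w" for y z
    unfolding win_def by (auto intro!: image_eqI[of _ _ "y + z"])
  have "(\<Sum>(b, x)\<in>hook_pairs B. balance l (b - x) * int (w - (b - x))) =
        (\<Sum>(b, x)\<in>hook_pairs B. \<Sum>z<Z. if z \<le> x \<and> b < z + w then balance l (b - x) else 0)"
  proof (rule sum.cong[OF refl], clarify)
    fix b x assume bx: "(b, x) \<in> hook_pairs B"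
    hence *: "b \<in> B" "x < b" "x \<notin> B" "w \<le> x"
      using B(2) by (auto simp: hook_pairs_def) (metis lessThan_iff not_less subsetD)
    have "{z\<in>{..<Z}. z \<le> x \<and> b < z + w} = {b + 1 - w..x}"
      using * less_Z[of b] by auto
    hence "card {z\<in>{..<Z}. z \<le> x \<and> b < z + w} = w - (b - x)"
      using * by simp
    thus "balance l (b - x) * int (w - (b - x)) =
          (\<Sum>z<Z. if z \<le> x \<and> b < z + w then balance l (b - x) else 0)"
      by (simp add: sum.If_cases Int_def mult.commute)
  qed
  also have "\<dots> = (\<Sum>z<Z. \<Sum>(b, x)\<in>hook_pairs B. if z \<le> x \<and> b < z + w then balance l (b - x) else 0)"
    unfolding case_prod_unfold by (rule sum.swap)
  also have "\<dots> = (\<Sum>z<Z. \<Sum>(b, x)\<in>hook_pairs (win z). balance l (b - x))"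
  proof (rule sum.cong[OF refl])
    fix z
    have "(\<Sum>(b, x)\<in>hook_pairs B. if z \<le> x \<and> b < z + w then balance l (b - x) else 0) =
          (\<Sum>(b, x)\<in>{p \<in> hook_pairs B. z \<le> snd p \<and> fst p < z + w}. balance l (b - x))"
      by (subst sum.inter_filter[OF finite_hook_pairs[OF B(1)]]) (auto intro!: sum.cong)
    also have "\<dots> = (\<Sum>(b, x)\<in>hook_pairs (win z). balance l (b - x))"
      by (rule sum.reindex_bij_witness[where i = "\<lambda>(b, x). (b + z, x + z)" and j = "\<lambda>(b, x). (b - z, x - z)"],
         auto simp: hook_pairs_def win_iff)
    finally show "(\<Sum>(b, x)\<in>hook_pairs B. if z \<le> x \<and> b < z + w then balance l (b - x) else 0) =
       (\<Sum>(b, x)\<in>hook_pairs (win z). balance l (b - x))" .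
  qed
  also have "\<dots> \<le> 0"
    using B(1) by (intro sum_nonpos sum_balance_hook_pairs_nonpos[OF l]) (simp add: win_def)
  finally show ?thesis .
qed

text \<open>
  Summation by parts, twice. The coefficients are negated second differences of the logarithm, and the truncated
  subtraction makes \<open>w - h\<close> the function \<open>max 0 (w - h)\<close>.
\<close>
lemma ln_concave_expansion:
  assumes "1 \<le> h" "h \<le> M"
  shows "ln (real h) = ln (real M) - (ln (real M) - ln (real (M - 1))) * real (M - h)
     - (\<Sum>w\<in>{2..<M}. (2 * ln (real w) - ln (real (w - 1)) - ln (real (w + 1))) * real (w - h))"
  using assms(2)
proof (induction M rule: dec_induct)
  case base
  have "(\<Sum>w\<in>{2..<h}. (2 * ln (real w) - ln (real (w - 1)) - ln (real (w + 1))) * real (w - h)) = 0"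
    by (intro sum.neutral) auto
  thus ?case by simp
next
  case (step M)
  define d where "d w = 2 * ln (real w) - ln (real (w - 1)) - ln (real (w + 1))" for w
  have "(\<Sum>w\<in>{2..<Suc M}. d w * real (w - h)) = (\<Sum>w\<in>{2..<M}. d w * real (w - h)) + d M * real (M - h)"
  proof (cases "M \<ge> 2")
    case False
    hence "M = 1" "h = 1" using step assms by auto
    thus ?thesis by simp
  qed simp
  note sum = this
  let ?S = "\<Sum>w\<in>{2..<M}. d w * real (w - h)"
  have R: "real (Suc M - h) = real (M - h) + 1" using step by (simp add: of_nat_diff)
  have dM: "d M = 2 * ln (real M) - ln (real (M - 1)) - ln (real (Suc M))" by (simp add: d_def)
  have "ln (real h) = ln (real M) - (ln (real M) - ln (real (M - 1))) * real (M - h) - ?S"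
    using step.IH unfolding d_def .
  also have "\<dots> = ln (real (Suc M)) - (ln (real (Suc M)) - ln (real (Suc M - 1))) * real (Suc M - h)
                  - (?S + d M * real (M - h))"
    unfolding R dM diff_Suc_1 by (simp add: ring_distribs)
  finally show ?case unfolding sum[symmetric] unfolding d_def .
qed

lemma ln_second_difference: 
  assumes "w \<ge> 2"
  shows "0 \<le> 2 * ln (real w) - ln (real (w - 1)) - ln (real (w + 1))"
proof -
  have "ln (real (w - 1)) + ln (real (w + 1)) = ln (real (w - 1) * real (w + 1))"
    using assms by (subst ln_mult) auto
  also have "\<dots> \<le> ln (real w * real w)"
  proof (rule ln_mono)
    show "0 < real (w - 1) * real (w + 1)" using assms by simp
    show "real (w - 1) * real (w + 1) \<le> real w * real w"
      using assms by (simp add: of_nat_diff algebra_simps)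
  qed
  also have "\<dots> = 2 * ln (real w)" using assms by (simp add: ln_mult)
  finally show ?thesis by simp
qed

text \<open>
  The inequality of Fomin and Lulov. In logarithms it says that the sum of \<open>ln h\<close> over the hooks, weighted by
  \<open>balance\<close>, is nonnegative. In the concave expansion the constant term drops out because the weights sum to 0, and every other term is a
  nonpositive window sum with a nonpositive coefficient.
\<close>
lemma prod_hooks_le_prod_divisible:
  assumes l: "l > 0" and B: "finite B" "{..<M} \<subseteq> B" and M: "\<And>b x. (b, x) \<in> hook_pairs B \<Longrightarrow> b - x \<le> M"
    and bal: "(\<Sum>(b, x)\<in>hook_pairs B. balance l (b - x)) = 0"
  shows "(\<Prod>(b, x)\<in>hook_pairs B. real (b - x)) \<le> (\<Prod>(b, x) | (b, x) \<in> hook_pairs B \<and> l dvd b - x. real (b - x)) ^ l"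
proof -
  define H where "H = hook_pairs B"
  define h where "h p = fst p - snd p" for p :: "nat \<times> nat"
  define g where "g p = real_of_int (balance l (h p))" for p
  define W where "W w = (\<Sum>p\<in>H. g p * real (w - h p))" for w
  have fin: "finite H" unfolding H_def by (rule finite_hook_pairs[OF B(1)])
  have h1: "1 \<le> h p" "h p \<le> M" if "p \<in> H" for p
    using that M by (auto simp: H_def h_def hook_pairs_def)
  have W: "W w \<le> 0" if "w \<le> M" for w
  proof -
    have "W w = of_int (\<Sum>(b, x)\<in>hook_pairs B. balance l (b - x) * int (w - (b - x)))"
      by (simp add: W_def g_def h_def H_def case_prod_unfold)
    also have "\<dots> \<le> 0"
      unfolding of_int_le_0_iff using B(2) that by (intro sum_balance_window_nonpos[OF l B(1)]) auto
    finally show ?thesis .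
  qed
  have g0: "(\<Sum>p\<in>H. g p) = 0"
    using arg_cong[OF bal, of real_of_int] by (simp add: g_def h_def H_def case_prod_unfold)
  define d where "d w = 2 * ln (real w) - ln (real (w - 1)) - ln (real (w + 1))" for w
  have d: "d w \<ge> 0" if "w \<ge> 2" for w using ln_second_difference[OF that] by (simp add: d_def)
  have "(\<Sum>p\<in>H. g p * ln (real (h p))) =
     (\<Sum>p\<in>H. ln (real M) * g p - (ln (real M) - ln (real (M - 1))) * (g p * real (M - h p))
           - (\<Sum>w\<in>{2..<M}. d w * (g p * real (w - h p))))"
  proof (rule sum.cong[OF refl])
    fix p assume "p \<in> H"
    note eq = ln_concave_expansion[OF h1[OF this], folded d_def]
    show "g p * ln (real (h p)) = ln (real M) * g p - (ln (real M) - ln (real (M - 1))) * (g p * real (M - h p))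
           - (\<Sum>w\<in>{2..<M}. d w * (g p * real (w - h p)))"
      by (subst eq) (simp add: right_diff_distrib sum_distrib_left mult_ac)
  qed
  also have "\<dots> = ln (real M) * (\<Sum>p\<in>H. g p) - (ln (real M) - ln (real (M - 1))) * W M
           - (\<Sum>w\<in>{2..<M}. d w * W w)"
    unfolding sum_subtractf sum_distrib_left[symmetric] W_def
    by (subst sum.swap) (simp add: sum_distrib_left)
  also have "\<dots> \<ge> 0"
  proof -
    have "(\<Sum>w\<in>{2..<M}. d w * W w) \<le> 0"
      by (intro sum_nonpos mult_nonneg_nonpos d W) auto
    moreover have "(ln (real M) - ln (real (M - 1))) * W M \<le> 0"
    proof (intro mult_nonneg_nonpos W)
      show "0 \<le> ln (real M) - ln (real (M - 1))" by (cases "M \<le> 1") (auto simp: le_Suc_eq)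
    qed simp
    ultimately show ?thesis by (simp add: g0)
  qed
  finally have key: "(\<Sum>p\<in>H. g p * ln (real (h p))) \<ge> 0" .
  define D where "D = {p\<in>H. l dvd h p}"
  have "g p * ln (real (h p)) = real l * (if l dvd h p then ln (real (h p)) else 0) - ln (real (h p))" for p
    by (simp add: g_def balance_def algebra_simps)
  hence "(\<Sum>p\<in>H. g p * ln (real (h p))) = real l * (\<Sum>p\<in>D. ln (real (h p))) - (\<Sum>p\<in>H. ln (real (h p)))"
    using fin by (simp add: sum_subtractf D_def sum.inter_filter flip: sum_distrib_left)
  with key have "(\<Sum>p\<in>H. ln (real (h p))) \<le> real l * (\<Sum>p\<in>D. ln (real (h p)))" by simp
  hence "exp (\<Sum>p\<in>H. ln (real (h p))) \<le> exp (real l * (\<Sum>p\<in>D. ln (real (h p))))" by simp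
  moreover have "exp (\<Sum>p\<in>X. ln (real (h p))) = (\<Prod>p\<in>X. real (h p))" if "X \<subseteq> H" for X
    using that h1(1) finite_subset[OF that fin] by (subst exp_sum) (auto intro!: prod.cong simp: Suc_le_eq subset_iff)
  ultimately have "(\<Prod>p\<in>H. real (h p)) \<le> (\<Prod>p\<in>D. real (h p)) ^ l"
    by (simp add: exp_of_nat_mult D_def)
  thus ?thesis by (simp add: H_def D_def h_def case_prod_unfold)
qed

section \<open>The major index polynomial at roots of unity\<close>

definition root_order :: "complex \<Rightarrow> nat \<Rightarrow> bool" where
  "root_order z l \<longleftrightarrow> l > 0 \<and> norm z = 1 \<and> (\<forall>m. z ^ m = 1 \<longleftrightarrow> l dvd m)"

text \<open>
  The limit of \<open>norm (1 - q ^ m)\<close> as \<open>q = t * z\<close> tends to \<open>z\<close>, after division by \<open>1 - t\<close> when the limit would be 0.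
\<close>
definition root_factor :: "complex \<Rightarrow> nat \<Rightarrow> nat \<Rightarrow> real" where
  "root_factor z l m = (if l dvd m then real m else norm (1 - z ^ m))"

lemma card_hook_pairs_beads:
  assumes "bounded_shape k n l"
  shows "card (hook_pairs (beads k l)) = n" "\<Sum>(beads k l) = n + \<Sum>{..<k}"
proof -
  have anti: "antimono l" and n: "(\<Sum>i<k. l i) = n" using assms by (auto simp: bounded_shape_def)
  have "\<Sum>(beads k l) = (\<Sum>i<k. l i + (k - 1 - i))"
    unfolding beads_def by (subst sum.reindex[OF inj_on_bead[OF anti]]) simp
  also have "\<dots> = n + (\<Sum>i<k. k - 1 - i)" unfolding sum.distrib n ..
  also have "(\<Sum>i<k. k - 1 - i) = \<Sum>{..<k}"
    using sum.nat_diff_reindex[of "\<lambda>i. i" k] by simp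
  finally show s: "\<Sum>(beads k l) = n + \<Sum>{..<k}" .
  have "\<Sum>(beads k l) = card (hook_pairs (beads k l)) + card (bead_pairs (beads k l))"
    using sum_hook_pairs[of "beads k l" "\<lambda>_ _. 1 :: nat"] by (simp add: case_prod_unfold)
  thus "card (hook_pairs (beads k l)) = n"
    using s card_beads[OF anti, of k] by (simp add: card_bead_pairs)
qed

text \<open>
  There are \<open>n\<close> hooks; where this sum is nonpositive, at most \<open>n / d\<close> of them are divisible by \<open>d\<close>.
\<close>
lemma sum_balance_beads:
  assumes "bounded_shape k n l"
  shows "(\<Sum>(b, x)\<in>hook_pairs (beads k l). balance d (b - x))
       = int d * int (card {p \<in> hook_pairs (beads k l). d dvd fst p - snd p}) - int n"
proof -
  have "(\<Sum>(b, x)\<in>hook_pairs (beads k l). balance d (b - x)) =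
        (\<Sum>p\<in>hook_pairs (beads k l). (if d dvd fst p - snd p then int d else 0) - 1)"
    by (intro sum.cong refl) (auto simp: balance_def)
  thus ?thesis using card_hook_pairs_beads(1)[OF assms] finite_hook_pairs[of "beads k l"]
    by (simp add: sum_subtractf sum.If_cases Int_def)
qed

lemma multiples_upto:
  fixes d n :: nat
  assumes d: "d > 0"
  shows "{m\<in>{1..n}. d dvd m} = (\<lambda>i. d * i) ` {1..n div d}"
proof (intro equalityI subsetI)
  fix m assume "m \<in> {m\<in>{1..n}. d dvd m}"
  hence m: "1 \<le> m" "m \<le> n" "d dvd m" by auto
  then obtain i where i: "m = d * i" by blast
  hence "i = m div d" using d by simp
  hence "i \<le> n div d" using m by (simp add: div_le_mono)
  moreover have "1 \<le> i" using m i by (cases i) auto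
  ultimately show "m \<in> (\<lambda>i. d * i) ` {1..n div d}" using i by auto
next
  fix m assume "m \<in> (\<lambda>i. d * i) ` {1..n div d}"
  then obtain i where "m = d * i" "i \<in> {1..n div d}" by (elim imageE)
  hence i: "m = d * i" "1 \<le> i" "i \<le> n div d" by auto
  have "d * i \<le> d * (n div d)" using i by simp
  also have "\<dots> \<le> n" by simp
  finally show "m \<in> {m\<in>{1..n}. d dvd m}" using i d by (simp add: Suc_le_eq)
qed

text \<open>
  The q-hook length formula at \<open>q = t * z\<close>, with the common power of \<open>1 - t\<close> cancelled, in the limit \<open>t \<rightarrow> 1\<close>. The
  factor \<open>0 ^ (n div d - c)\<close> is 1 if the orders of vanishing agree and 0 otherwise.
\<close>
lemma maj_sum_at_root:
  assumes z: "root_order z d" and l: "bounded_shape k n l"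
  defines "c \<equiv> card {p \<in> hook_pairs (beads k l). d dvd fst p - snd p}"
  shows "norm (maj_sum z n l) * (\<Prod>(b, x)\<in>hook_pairs (beads k l). root_factor z d (b - x))
       = (\<Prod>m=1..n. root_factor z d m) * 0 ^ (n div d - c)"
proof -
  have d: "d > 0" and nz: "norm z = 1" and zd: "z ^ m = 1 \<longleftrightarrow> d dvd m" for m
    using z by (auto simp: root_order_def)
  define H where "H = hook_pairs (beads k l)"
  define h where "h p = fst p - snd p" for p :: "nat \<times> nat"
  have finH: "finite H" unfolding H_def by (rule finite_hook_pairs) simp
  define e where "e = (\<Sum>j<k. \<Sum>m<k - 1 - j. m)"
  define e' where "e' = (\<Sum>(b, x)\<in>bead_pairs (beads k l). x)"
  \<comment> \<open>The factor of \<open>m\<close> at \<open>q = t * z\<close>, divided by \<open>1 - t\<close> if it vanishes at \<open>t = 1\<close>.\<close>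
  define g where "g m t = (if d dvd m then \<Sum>i<m. t ^ i else norm (1 - (of_real t * z) ^ m))" for m and t :: real
  have lim_g: "(g m \<longlongrightarrow> root_factor z d m) (at_left 1)" for m
  proof (cases "d dvd m")
    case True
    have "((\<lambda>t::real. \<Sum>i<m. t ^ i) \<longlongrightarrow> (\<Sum>i<m. 1 ^ i)) (at_left 1)"
      by (intro tendsto_intros)
    thus ?thesis using True by (simp add: g_def[abs_def] root_factor_def)
  next
    case False
    have "((\<lambda>t. norm (1 - (of_real t * z) ^ m)) \<longlongrightarrow> norm (1 - (of_real 1 * z) ^ m)) (at_left 1)"
      by (intro tendsto_intros)
    thus ?thesis using False by (simp add: g_def[abs_def] root_factor_def)
  qed
  have fac: "norm (1 - (of_real t * z) ^ m) = g m t * (if d dvd m then 1 - t else 1)" if "0 < t" "t < 1" for t m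
  proof (cases "d dvd m")
    case True
    hence "(of_real t * z) ^ m = of_real (t ^ m)" using zd by (simp add: power_mult_distrib)
    hence "norm (1 - (of_real t * z) ^ m) = norm (of_real (1 - t ^ m) :: complex)" by simp
    also have "\<dots> = 1 - t ^ m" using that by (subst norm_of_real) (simp add: power_le_one)
    also have "\<dots> = (1 - t) * (\<Sum>i<m. t ^ i)" by (rule one_diff_power_eq)
    finally show ?thesis using True by (simp add: g_def mult.commute)
  qed (simp add: g_def)
  \<comment> \<open>The hooks do not contribute more zeros than \<open>q_fact\<close>, so the powers of \<open>1 - t\<close> cancel.\<close>
  have cn: "c \<le> n div d"
  proof -
    have "int d * int c - int n \<le> 0"
      using sum_balance_beads[OF l, of d] sum_balance_hook_pairs_nonpos[OF d finite_beads, of k l]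
      by (simp add: c_def)
    hence "d * c \<le> n" by (simp flip: of_nat_mult)
    thus ?thesis using d by (simp add: less_eq_div_iff_mult_less_eq mult.commute)
  qed
  have cardn: "card {m\<in>{1..n}. d dvd m} = n div d"
  proof -
    note multiples_upto[OF d]
    thus ?thesis using d by (simp add: card_image inj_on_def)
  qed
  have eq: "norm (maj_sum (of_real t * z) n l) * t ^ e * (\<Prod>p\<in>H. g (h p) t)
          = (\<Prod>m=1..n. g m t) * (1 - t) ^ (n div d - c) * t ^ e'" if t: "0 < t" "t < 1" for t
  proof -
    have nt: "norm (of_real t * z) = t" using t nz by (simp add: norm_mult)
    have "(of_real t * z) ^ m \<noteq> 1" if "m > 0" for m
    proof
      assume "(of_real t * z) ^ m = 1"
      hence "t ^ m = 1" using nt by (metis norm_one norm_power)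
      thus False using power_Suc_less_one[OF _ t(2), of "m - 1"] t that by simp
    qed
    hence nr: "non_root (of_real t * z)" using t nz by (auto simp: non_root_def)
    have P1: "(\<Prod>p\<in>H. norm (1 - (of_real t * z) ^ h p)) = (\<Prod>p\<in>H. g (h p) t) * (1 - t) ^ c"
      using finH by (simp add: fac[OF t] prod.distrib prod.If_cases c_def H_def h_def Int_def)
    have P2: "norm (q_fact (of_real t * z) n) = (\<Prod>m=1..n. g m t) * (1 - t) ^ (n div d)"
      using cardn by (simp add: q_fact_def prod_norm[symmetric] fac[OF t] prod.distrib prod.If_cases Int_def)
    have "norm (maj_sum (of_real t * z) n l) * t ^ e * ((\<Prod>p\<in>H. g (h p) t) * (1 - t) ^ c)
       = (\<Prod>m=1..n. g m t) * (1 - t) ^ (n div d) * t ^ e'"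
      using norm_maj_sum_hooks[OF nr l] unfolding nt P1[symmetric] P2[symmetric]
      by (simp add: e_def e'_def H_def h_def case_prod_unfold)
    also have "(1 - t) ^ (n div d) = (1 - t) ^ (n div d - c) * (1 - t) ^ c"
      using cn by (simp flip: power_add)
    finally show ?thesis using t by simp
  qed
  have "((\<lambda>t. norm (maj_sum (of_real t * z) n l) * t ^ e * (\<Prod>p\<in>H. g (h p) t)) \<longlongrightarrow>
        norm (maj_sum (of_real 1 * z) n l) * 1 ^ e * (\<Prod>p\<in>H. root_factor z d (h p))) (at_left 1)"
    unfolding maj_sum_def by (intro tendsto_intros lim_g)
  moreover have "((\<lambda>t. (\<Prod>m=1..n. g m t) * (1 - t) ^ (n div d - c) * t ^ e') \<longlongrightarrow>
        (\<Prod>m=1..n. root_factor z d m) * (1 - 1) ^ (n div d - c) * 1 ^ e') (at_left 1)"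
    by (intro tendsto_intros lim_g)
  hence "((\<lambda>t. norm (maj_sum (of_real t * z) n l) * t ^ e * (\<Prod>p\<in>H. g (h p) t)) \<longlongrightarrow>
        (\<Prod>m=1..n. root_factor z d m) * (1 - 1) ^ (n div d - c) * 1 ^ e') (at_left 1)"
  proof (rule Lim_transform_eventually)
    show "\<forall>\<^sub>F t in at_left 1. (\<Prod>m=1..n. g m t) * (1 - t) ^ (n div d - c) * t ^ e' =
       norm (maj_sum (of_real t * z) n l) * t ^ e * (\<Prod>p\<in>H. g (h p) t)"
    proof -
      have "\<forall>\<^sub>F t in at_left (1 :: real). t \<in> {0<..<1}" by (rule eventually_at_left_real) simp
      thus ?thesis by eventually_elim (simp add: eq)
    qed
  qed
  ultimately have "norm (maj_sum (of_real 1 * z) n l) * 1 ^ e * (\<Prod>p\<in>H. root_factor z d (h p)) =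
       (\<Prod>m=1..n. root_factor z d m) * (1 - 1) ^ (n div d - c) * 1 ^ e'"
    by (rule tendsto_unique[OF trivial_limit_at_left_real])
  thus ?thesis by (simp add: H_def h_def case_prod_unfold)
qed

text \<open>
  The hook length formula, as the case \<open>z = 1\<close>.
\<close>
lemma card_lattice_words_hooks:
  assumes "bounded_shape k n l"
  shows "real (card (lattice_words n l)) * (\<Prod>(b, x)\<in>hook_pairs (beads k l). real (b - x)) = fact n"
proof -
  have 1: "root_order 1 1" by (simp add: root_order_def)
  have "card (hook_pairs (beads k l)) = n" by (rule card_hook_pairs_beads(1)[OF assms])
  thus ?thesis using maj_sum_at_root[OF 1 assms]
    by (simp add: maj_sum_def root_factor_def fact_prod)
qed

section \<open>Hook lengths outside the multiples of the order\<close>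

lemma prod_residues:
  fixes f :: "nat \<Rightarrow> real"
  assumes "d > 0" "finite B" "\<And>r. r < d \<Longrightarrow> card (runner d r B) = t"
  shows "(\<Prod>x\<in>B. f (x mod d)) = (\<Prod>r<d. f r ^ t)"
proof -
  have "(\<Prod>x\<in>B. f (x mod d)) = (\<Prod>r<d. \<Prod>x\<in>runner d r B. f (x mod d))"
    unfolding runner_def using prod.group[of B "{..<d}" "\<lambda>x. x mod d" "\<lambda>x. f (x mod d)"] assms(1,2)
    by (simp add: image_subset_iff)
  also have "\<dots> = (\<Prod>r<d. f r ^ t)"
    by (intro prod.cong refl) (simp add: runner_def assms(3)[unfolded runner_def])
  finally show ?thesis .
qed

lemma sum_residues:
  assumes "d > 0" "finite B" "\<And>r. r < d \<Longrightarrow> card (runner d r B) = t"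
  shows "(\<Sum>x\<in>B. x mod d) = (\<Sum>r<d. t * r)"
proof -
  have "(\<Sum>x\<in>B. x mod d) = (\<Sum>r<d. \<Sum>x\<in>runner d r B. x mod d)"
    unfolding runner_def using sum.group[of B "{..<d}" "\<lambda>x. x mod d" "\<lambda>x. x mod d"] assms(1,2)
    by (simp add: image_subset_iff)
  also have "\<dots> = (\<Sum>r<d. t * r)"
    by (intro sum.cong refl) (simp add: runner_def assms(3)[unfolded runner_def])
  finally show ?thesis .
qed

text \<open>
  Squaring makes the product symmetric, so that it can be evaluated by residue classes.
\<close>
lemma prod_bead_pairs_square:
  fixes f :: "nat \<Rightarrow> nat \<Rightarrow> real"
  assumes "finite B" "\<And>a b. f a b = f b a" "\<And>a. f a a = 1"
  shows "(\<Prod>(b, x)\<in>bead_pairs B. f b x) ^ 2 = (\<Prod>b\<in>B. \<Prod>x\<in>B. f b x)"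
  using assms(1)
proof (induction B rule: finite_linorder_max_induct)
  case (insert b A)
  have bA: "b \<notin> A" using insert by auto
  have "bead_pairs (insert b A) = {b} \<times> A \<union> bead_pairs A"
    using insert by (auto simp: bead_pairs_def)
  moreover have "({b} \<times> A) \<inter> bead_pairs A = {}" using bA by (auto simp: bead_pairs_def)
  ultimately have "(\<Prod>(b, x)\<in>bead_pairs (insert b A). f b x) = (\<Prod>(b, x)\<in>{b} \<times> A. f b x) * (\<Prod>(b, x)\<in>bead_pairs A. f b x)"
    using insert by (simp add: prod.union_disjoint finite_bead_pairs)
  also have "(\<Prod>(b, x)\<in>{b} \<times> A. f b x) = (\<Prod>x\<in>A. f b x)"
    by (simp flip: prod.Sigma prod.cartesian_product)
  finally have *: "(\<Prod>(b, x)\<in>bead_pairs (insert b A). f b x) = (\<Prod>x\<in>A. f b x) * (\<Prod>(b, x)\<in>bead_pairs A. f b x)" .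
  moreover have "(\<Prod>x\<in>A. f x b) = (\<Prod>x\<in>A. f b x)"
    by (rule prod.cong[OF refl]) (rule assms(2))
  ultimately show ?case unfolding * using insert bA assms(3)[of b]
    by (simp add: power_mult_distrib prod.distrib power2_eq_square mult_ac)
qed (simp add: bead_pairs_def)

definition nonmultiple_factor :: "complex \<Rightarrow> nat \<Rightarrow> nat \<Rightarrow> real" where
  "nonmultiple_factor z d m = (if d dvd m then 1 else norm (1 - z ^ m))"

text \<open>
  All factors depend on residues modulo \<open>d\<close> only, and all runners contain \<open>t\<close> beads, as they do for the
  bead set \<open>{..<k}\<close> of the empty shape. Hence the pairs of two beads contribute the same as for the empty shape, and the
  surplus of all pairs is one full period for each of the \<open>n / d\<close> places by which the beads have
  moved up their runners in total.
\<close>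
lemma prod_nonmultiple_factor_hooks:
  assumes z: "root_order z d" and l: "bounded_shape k n l" and k: "k = d * t" and n: "d dvd n"
    and bal: "(\<Sum>(b, x)\<in>hook_pairs (beads k l). balance d (b - x)) = 0"
  shows "(\<Prod>(b, x)\<in>hook_pairs (beads k l). nonmultiple_factor z d (b - x)) = (\<Prod>m=1..n. nonmultiple_factor z d m)"
proof -
  have d: "d > 0" and nz: "norm z = 1" and zd: "z ^ m = 1 \<longleftrightarrow> d dvd m" for m
    using z by (auto simp: root_order_def)
  define u where "u = nonmultiple_factor z d"
  have pos: "u m > 0" for m using zd[of m] by (auto simp: u_def nonmultiple_factor_def)
  have z_mod: "z ^ m = z ^ (m mod d)" for m
  proof -
    have "z ^ m = z ^ (d * (m div d) + m mod d)" by simp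
    also have "\<dots> = (z ^ d) ^ (m div d) * z ^ (m mod d)" by (simp only: power_add power_mult)
    finally show ?thesis using zd[of d] by simp
  qed
  have u_mod: "u m = u (m mod d)" for m
    using z_mod[of m] by (simp add: u_def nonmultiple_factor_def dvd_eq_mod_eq_0)
  define V where "V b = (\<Prod>m=1..b. u m)" for b
  have V_pos: "V b > 0" for b by (simp add: V_def pos prod_pos)
  \<comment> \<open>The product over one full period.\<close>
  define U where "U = V d"
  have V_add: "V (d * q + b) = U ^ q * V b" for q b
  proof (induction q)
    case (Suc q)
    have "V (d + c) = U * V c" for c
    proof (induction c)
      case (Suc c)
      have "u (Suc (d + c)) = u (Suc c)" unfolding u_mod[of "Suc (d + c)"] u_mod[of "Suc c"]
        by (simp only: mod_add_self1 flip: add_Suc_right)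
      thus ?case using Suc by (simp add: V_def)
    qed (simp add: V_def U_def)
    from this[of "d * q + b"] show ?case using Suc by (simp add: add.assoc mult.assoc)
  qed simp
  \<comment> \<open>A symmetric version of \<open>u (a - b)\<close> that makes sense for all pairs.\<close>
  define f where "f a b = (if a mod d = b mod d then 1 else norm (z ^ a - z ^ b))" for a b
  have f: "f a b = f b a" "f a a = 1" "f a b = f (a mod d) (b mod d)" for a b
    using z_mod[of a] z_mod[of b] by (auto simp: f_def norm_minus_commute)
  have f_nonneg: "f a b \<ge> 0" for a b by (simp add: f_def)
  have fu: "u (b - x) = f b x" if "x \<le> b" for b x
  proof -
    have "z ^ x - z ^ b = z ^ x * (1 - z ^ (b - x))" using that by (simp add: right_diff_distrib flip: power_add)
    hence "norm (z ^ b - z ^ x) = norm (1 - z ^ (b - x))"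
      by (simp add: norm_minus_commute[of "z ^ b"] norm_mult norm_power nz)
    moreover have "d dvd b - x \<longleftrightarrow> b mod d = x mod d" using mod_eq_dvd_iff_nat[OF that, of d] by simp
    ultimately show ?thesis by (simp add: u_def nonmultiple_factor_def f_def)
  qed
  define S where "S = sqrt (\<Prod>r<d. (\<Prod>s<d. f r s ^ t) ^ t)"
  have main: "(\<Prod>(b, x)\<in>hook_pairs B. u (b - x)) * S = U ^ (\<Sum>b\<in>B. b div d) * (\<Prod>r<d. V r ^ t)" 
    if B: "finite B" "\<And>r. r < d \<Longrightarrow> card (runner d r B) = t" for B
  proof -
    have "(\<Prod>(b, x)\<in>bead_pairs B. f b x) ^ 2 = (\<Prod>b\<in>B. \<Prod>x\<in>B. f (b mod d) (x mod d))"
      using prod_bead_pairs_square[OF B(1), of f, OF f(1,2)] by (simp flip: f(3))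
    also have "\<dots> = (\<Prod>r<d. (\<Prod>s<d. f r s ^ t) ^ t)"
      using prod_residues[OF d B, of "\<lambda>r. \<Prod>s<d. f r s ^ t"] prod_residues[OF d B, of "f (b mod d)" for b] by simp
    finally have "sqrt ((\<Prod>(b, x)\<in>bead_pairs B. f b x) ^ 2) = S" by (simp add: S_def)
    hence "(\<Prod>(b, x)\<in>bead_pairs B. f b x) = S"
      using f_nonneg by (subst (asm) real_sqrt_abs) (simp add: prod_nonneg case_prod_unfold)
    moreover have "(\<Prod>(b, x)\<in>bead_pairs B. u (b - x)) = (\<Prod>(b, x)\<in>bead_pairs B. f b x)"
      by (rule prod.cong) (auto simp: bead_pairs_def fu)
    ultimately have 1: "(\<Prod>b\<in>B. \<Prod>x<b. u (b - x)) = (\<Prod>(b, x)\<in>hook_pairs B. u (b - x)) * S"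
      using prod_hook_pairs[OF B(1), of "\<lambda>b x. u (b - x)"] by simp
    have "(\<Prod>b\<in>B. \<Prod>x<b. u (b - x)) = (\<Prod>b\<in>B. U ^ (b div d) * V (b mod d))"
    proof (rule prod.cong[OF refl])
      fix b
      have "(\<Prod>x<b. u (b - x)) = V b"
        unfolding V_def by (rule prod.reindex_bij_witness[where i = "\<lambda>x. b - x" and j = "\<lambda>m. b - m"]) auto
      also have "\<dots> = U ^ (b div d) * V (b mod d)"
        using V_add[of "b div d" "b mod d"] by simp
      finally show "(\<Prod>x<b. u (b - x)) = U ^ (b div d) * V (b mod d)" .
    qed
    thus ?thesis using 1 prod_residues[OF d B, of V] by (simp add: prod.distrib power_sum)
  qed
  have anti: "antimono l" using l by (simp add: bounded_shape_def)
  have cB: "card (runner d r (beads k l)) = t" if "r < d" for r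
    using card_runner_if_balanced[OF d finite_beads bal _ that] card_beads[OF anti, of k] k by simp
  have empty: "hook_pairs {..<k} = {}" by (auto simp: hook_pairs_def)
  have c0: "card (runner d r {..<k}) = t" if "r < d" for r
    using card_runner_if_balanced[OF d _ _ _ that, of "{..<k}" t] empty k by simp
  have 1: "(\<Prod>(b, x)\<in>hook_pairs (beads k l). u (b - x)) * S = U ^ (\<Sum>b\<in>beads k l. b div d) * (\<Prod>r<d. V r ^ t)"
    by (rule main) (use cB in auto)
  have 2: "S = U ^ (\<Sum>b<k. b div d) * (\<Prod>r<d. V r ^ t)"
    using main[of "{..<k}"] c0 empty by simp
  have div: "\<Sum>B = d * (\<Sum>b\<in>B. b div d) + (\<Sum>r<d. t * r)"
    if "finite B" "\<And>r. r < d \<Longrightarrow> card (runner d r B) = t" for B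
  proof -
    have "\<Sum>B = (\<Sum>b\<in>B. d * (b div d) + b mod d)" by simp
    also have "\<dots> = d * (\<Sum>b\<in>B. b div d) + (\<Sum>b\<in>B. b mod d)"
      by (simp only: sum.distrib sum_distrib_left)
    also have "(\<Sum>b\<in>B. b mod d) = (\<Sum>r<d. t * r)" by (rule sum_residues[OF d that])
    finally show ?thesis .
  qed
  have "d * (\<Sum>b\<in>beads k l. b div d) = n + d * (\<Sum>b<k. b div d)"
    using div[of "beads k l"] div[of "{..<k}"] cB c0 card_hook_pairs_beads(2)[OF l] by simp
  moreover obtain s where s: "n = d * s" using n by blast
  ultimately have "d * (\<Sum>b\<in>beads k l. b div d) = d * (s + (\<Sum>b<k. b div d))" by (simp add: distrib_left)
  hence "(\<Sum>b\<in>beads k l. b div d) = s + (\<Sum>b<k. b div d)" using d by simp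
  hence "(\<Prod>(b, x)\<in>hook_pairs (beads k l). u (b - x)) * S = U ^ s * S"
    unfolding 1 by (subst 2) (simp add: power_add)
  moreover have "S > 0" unfolding 2 U_def by (intro mult_pos_pos prod_pos zero_less_power V_pos)
  moreover have "V n = U ^ s" using V_add[of s 0] s by (simp add: V_def)
  ultimately show ?thesis by (simp add: u_def V_def)
qed

section \<open>The Fomin--Lulov bound and equidistribution\<close>

text \<open>
  The value at \<open>z\<close> is \<open>d ^ s * fact s\<close> divided by the product of the hooks divisible by \<open>d\<close>; its \<open>d\<close>-th power
  is compared with the hook length formula by the Fomin--Lulov inequality.
\<close>
lemma maj_sum_root_hook_bound:
  assumes z: "root_order z d" and l: "bounded_shape k n l" and k: "k = d * t" and n: "d dvd n"
    and M: "{..<M} \<subseteq> beads k l" "\<And>b x. (b, x) \<in> hook_pairs (beads k l) \<Longrightarrow> b - x \<le> M"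
  shows "norm (maj_sum z n l) ^ d * fact n \<le> (real d ^ (n div d) * fact (n div d)) ^ d * real (card (lattice_words n l))"
proof -
  have d: "d > 0" using z by (simp add: root_order_def)
  define H where "H = hook_pairs (beads k l)"
  define h where "h p = fst p - snd p" for p :: "nat \<times> nat"
  define D where "D = {p\<in>H. d dvd h p}"
  have finH: "finite H" by (simp add: H_def finite_hook_pairs)
  have h_pos: "h p > 0" if "p \<in> H" for p using that by (auto simp: H_def h_def hook_pairs_def)
  have f: "real (card (lattice_words n l)) * (\<Prod>p\<in>H. real (h p)) = fact n"
    using card_lattice_words_hooks[OF l] by (simp add: H_def h_def case_prod_unfold)
  have at_root: "norm (maj_sum z n l) * (\<Prod>p\<in>H. root_factor z d (h p)) =
     (\<Prod>m=1..n. root_factor z d m) * 0 ^ (n div d - card D)"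
    using maj_sum_at_root[OF z l] by (simp add: H_def h_def D_def case_prod_unfold)
  have zd: "z ^ m = 1 \<longleftrightarrow> d dvd m" for m using z by (simp add: root_order_def)
  have "norm (1 - z ^ m) \<noteq> 0" if "\<not> d dvd m" for m using that zd[of m] by auto
  hence rf_nz: "root_factor z d m \<noteq> 0" if "m > 0" for m using that by (auto simp: root_factor_def)
  show ?thesis
  proof (cases "n div d \<le> card D")
    case False
    hence "norm (maj_sum z n l) * (\<Prod>p\<in>H. root_factor z d (h p)) = 0" using at_root by simp
    hence "norm (maj_sum z n l) = 0" using rf_nz h_pos finH by (auto simp: prod_zero_iff)
    thus ?thesis using d by (auto simp: zero_power intro!: mult_nonneg_nonneg)
  next
    case True
    have sum_bal: "(\<Sum>(b, x)\<in>H. balance d (b - x)) = int d * int (card D) - int n"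
      using sum_balance_beads[OF l, of d] by (simp add: H_def D_def h_def)
    have "n = d * (n div d)" using n by simp
    also have "\<dots> \<le> d * card D" using True by simp
    finally have "int n \<le> int d * int (card D)" by (simp flip: of_nat_mult)
    with sum_balance_hook_pairs_nonpos[OF d finite_beads, of k l] sum_bal
    have bal: "(\<Sum>(b, x)\<in>H. balance d (b - x)) = 0" by (simp add: H_def)
    have split: "(\<Prod>i\<in>A. root_factor z d (g i)) = (\<Prod>i\<in>{i\<in>A. d dvd g i}. real (g i)) * (\<Prod>i\<in>A. nonmultiple_factor z d (g i))"
      if "finite A" for A and g :: "'b \<Rightarrow> nat"
    proof -
      have "(\<Prod>i\<in>A. root_factor z d (g i)) = (\<Prod>i\<in>A. (if d dvd g i then real (g i) else 1) * nonmultiple_factor z d (g i))"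
        by (rule prod.cong) (auto simp: root_factor_def nonmultiple_factor_def)
      thus ?thesis using that by (simp add: prod.distrib prod.inter_filter)
    qed
    have "(\<Prod>i\<in>{m\<in>{1..n}. d dvd m}. real i) = (\<Prod>i\<in>{1..n div d}. real (d * i))"
      unfolding multiples_upto[OF d] using d by (subst prod.reindex) (auto simp: inj_on_def)
    also have "\<dots> = real d ^ (n div d) * fact (n div d)"
      by (simp add: prod.distrib fact_prod)
    finally have div: "(\<Prod>i\<in>{m\<in>{1..n}. d dvd m}. real i) = real d ^ (n div d) * fact (n div d)" .
    define u where "u = (\<Prod>m=1..n. nonmultiple_factor z d m)"
    have "u \<noteq> 0" using zd by (auto simp: u_def nonmultiple_factor_def prod_zero_iff)
    have "(\<Prod>p\<in>H. nonmultiple_factor z d (h p)) = u"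
      using prod_nonmultiple_factor_hooks[OF z l k n] bal by (simp add: H_def h_def u_def case_prod_unfold)
    hence "norm (maj_sum z n l) * ((\<Prod>p\<in>D. real (h p)) * u) = real d ^ (n div d) * fact (n div d) * u"
      using at_root True split[OF finH, of h] split[of "{1..n}" "\<lambda>m. m"] div by (simp add: D_def u_def)
    hence F: "norm (maj_sum z n l) * (\<Prod>p\<in>D. real (h p)) = real d ^ (n div d) * fact (n div d)"
      using \<open>u \<noteq> 0\<close> by simp
    have ineq: "(\<Prod>p\<in>H. real (h p)) \<le> (\<Prod>p\<in>D. real (h p)) ^ d"
      using prod_hooks_le_prod_divisible[OF d finite_beads M] bal
      by (simp add: H_def h_def D_def case_prod_unfold)
    have "norm (maj_sum z n l) ^ d * fact n =
          norm (maj_sum z n l) ^ d * (\<Prod>p\<in>H. real (h p)) * real (card (lattice_words n l))"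
      using f by (simp add: mult_ac)
    also have "\<dots> \<le> norm (maj_sum z n l) ^ d * (\<Prod>p\<in>D. real (h p)) ^ d * real (card (lattice_words n l))"
      by (intro mult_right_mono mult_left_mono ineq) auto
    also have "\<dots> = (real d ^ (n div d) * fact (n div d)) ^ d * real (card (lattice_words n l))"
      unfolding F[symmetric] by (simp add: power_mult_distrib)
    finally show ?thesis .
  qed
qed

text \<open>
  The multinomial coefficient of \<open>d\<close> blocks of size \<open>s\<close> falls short of its trivial bound \<open>d ^ (d * s)\<close> by a
  factor of at most \<open>(d * s) ^ (d - 1)\<close>. In the step from \<open>s\<close> to \<open>s + 1\<close> each of the new factors
  \<open>d * s + i\<close> is estimated by \<open>d * s\<close>, except the last.
\<close>
lemma equal_blocks_factorial_bound:
  assumes "d > 0" "s > 0"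
  shows "(d ^ s * fact s) ^ d \<le> fact (d * s) * (d * s) ^ (d - 1)"
  using assms(2)
proof (induction s rule: nat_induct_non_zero)
  case 1
  have "d \<le> fact d" by (rule fact_ge_self)
  hence "d * d ^ (d - 1) \<le> fact d * d ^ (d - 1)" by (rule mult_right_mono) simp
  thus ?case using assms(1) by (simp add: power_eq_if)
next
  case (Suc s)
  have fact_step: "fact (m + j) = fact m * (\<Prod>i=1..j. m + i)" for m j :: nat
    by (induction j) (simp_all add: algebra_simps)
  \<comment> \<open>The factor \<open>s ^ e\<close> is carried along to avoid the fraction \<open>((s + 1) / s) ^ e\<close>.\<close>
  obtain e where e: "d = Suc e" using assms(1) by (cases d) auto
  have pow: "(d * s) ^ e \<le> (\<Prod>i=1..e. d * s + i)"
    using prod_mono[of "{1..e}" "\<lambda>_. d * s" "\<lambda>i. d * s + i"] by simp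
  have main: "(d * Suc s) * (d * s) ^ e \<le> (\<Prod>i=1..d. d * s + i)"
  proof -
    have P: "(\<Prod>i=1..d. c + i) = (\<Prod>i=1..e. c + i) * (c + d)" for c by (simp add: e)
    have "(d * Suc s) * (d * s) ^ e \<le> (d * Suc s) * (\<Prod>i=1..e. d * s + i)"
      using pow by (rule mult_le_mono2)
    thus ?thesis unfolding P by (simp add: add.commute mult.commute)
  qed
  have "(d ^ Suc s * fact (Suc s)) ^ d * s ^ e = (d ^ s * fact s) ^ d * ((d * Suc s) ^ d * s ^ e)"
  proof -
    have "d ^ Suc s * fact (Suc s) = (d ^ s * fact s) * (d * Suc s)"
      by (simp only: power_Suc fact_Suc of_nat_id mult_ac)
    thus ?thesis by (simp only: power_mult_distrib mult_ac)
  qed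
  also have "\<dots> \<le> fact (d * s) * (d * s) ^ e * ((d * Suc s) ^ d * s ^ e)"
    using Suc.IH by (intro mult_right_mono) (auto simp: e)
  also have "\<dots> = fact (d * s) * ((d * Suc s) * (d * s) ^ e) * (d * Suc s) ^ e * s ^ e"
  proof -
    have "(d * Suc s) ^ d = (d * Suc s) * (d * Suc s) ^ e" by (simp only: e power_Suc)
    thus ?thesis by (simp only: mult.assoc mult.left_commute)
  qed
  also have "\<dots> \<le> fact (d * s) * (\<Prod>i=1..d. d * s + i) * (d * Suc s) ^ e * s ^ e"
    by (intro mult_right_mono mult_left_mono main) auto
  also have "\<dots> = fact (d * Suc s) * (d * Suc s) ^ e * s ^ e"
    using fact_step[of "d * s" d] by (simp add: add.commute)
  finally show ?case using Suc.hyps by (simp add: e)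
qed

lemma bounded_shape_le:
  assumes "bounded_shape k n l"
  shows "l i \<le> n"
proof (cases "i < k")
  case True
  thus ?thesis using assms member_le_sum[of i "{..<k}" l] by (auto simp: bounded_shape_def)
qed (use assms in \<open>auto simp: bounded_shape_def\<close>)

lemma bounded_shape_pad:
  assumes "bounded_shape k n l" "k \<le> m"
  shows "bounded_shape m n l"
proof -
  have "(\<Sum>i<m. l i) = (\<Sum>i<k. l i)"
    using assms by (intro sum.mono_neutral_right) (auto simp: bounded_shape_def)
  thus ?thesis using assms by (simp add: bounded_shape_def)
qed

text \<open>
  From \<open>norm F ^ d \<le> n ^ (d - 1) * f\<close> the claim needs \<open>n ^ (3 * d - 1) \<le> f ^ (d - 1)\<close>, and
  \<open>3 * d - 1 \<le> 5 * (d - 1)\<close> holds for \<open>d \<ge> 2\<close>, with equality for \<open>d = 2\<close>.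
\<close>
lemma norm_maj_sum_root_le:
  assumes z: "root_order z d" and d: "d \<ge> 2" "d dvd n" "n > 0" and l: "bounded_shape n n l"
    and f: "card (lattice_words n l) \<ge> n ^ 5"
  shows "norm (maj_sum z n l) \<le> real (card (lattice_words n l)) / real n ^ 2"
proof -
  define f where "f = real (card (lattice_words n l))"
  define s where "s = n div d"
  have ds: "d * s = n" using d by (simp add: s_def)
  have s: "s > 0" using ds d by (cases s) auto
  \<comment> \<open>With \<open>3 * n\<close> rows the number of beads is a multiple of \<open>d\<close>, the lowest \<open>2 * n\<close> positions are beads, and no hook is longer than \<open>2 * n\<close>.\<close>
  have pad: "bounded_shape (3 * n) n l" by (rule bounded_shape_pad[OF l]) simp
  have B: "{..<2 * n} \<subseteq> beads (3 * n) l"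
  proof
    fix y assume y: "y \<in> {..<2 * n}"
    have "l (3 * n - 1 - y) = 0" using y l by (auto simp: bounded_shape_def)
    hence "y = l (3 * n - 1 - y) + (3 * n - 1 - (3 * n - 1 - y))" using y by simp
    thus "y \<in> beads (3 * n) l" using y d unfolding beads_def by (intro image_eqI[of _ _ "3 * n - 1 - y"]) auto
  qed
  have M: "b - x \<le> 2 * n" if "(b, x) \<in> hook_pairs (beads (3 * n) l)" for b x
  proof -
    have "b \<in> beads (3 * n) l" using that by (simp add: hook_pairs_def)
    then obtain i where "b = l i + (3 * n - 1 - i)" unfolding beads_def by (rule imageE)
    moreover have "l i \<le> n" by (rule bounded_shape_le[OF l])
    moreover have "x \<ge> 2 * n" using that B by (auto simp: hook_pairs_def) (meson lessThan_iff not_le subsetD)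
    ultimately show ?thesis by linarith
  qed
  have "norm (maj_sum z n l) ^ d * fact n \<le> (real d ^ s * fact s) ^ d * f"
    unfolding s_def f_def
    by (rule maj_sum_root_hook_bound[OF z pad _ d(2) B M, of "3 * s"]) (use ds in auto)
  also have "(real d ^ s * fact s) ^ d = real ((d ^ s * fact s) ^ d)" by simp
  also have "\<dots> * f \<le> real (fact (d * s) * (d * s) ^ (d - 1)) * f"
    by (intro mult_right_mono) (use equal_blocks_factorial_bound[of d s] d s in \<open>auto simp: f_def simp del: of_nat_mult of_nat_power\<close>)
  finally have "norm (maj_sum z n l) ^ d * fact n \<le> (real n ^ (d - 1) * f) * fact n"
    by (simp add: ds mult_ac)
  hence 1: "norm (maj_sum z n l) ^ d \<le> real n ^ (d - 1) * f" by simp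
  have fn: "real n ^ 5 \<le> f" using f unfolding f_def by (metis of_nat_le_iff of_nat_power)
  have n1: "real n \<ge> 1" using d by simp
  have f0: "f \<ge> 0" by (simp add: f_def)
  have "real n ^ (d - 1) * real n ^ (2 * d) \<le> real n ^ (5 * (d - 1))"
    unfolding power_add[symmetric] using d by (intro power_increasing n1) simp
  also have "\<dots> \<le> f ^ (d - 1)" unfolding power_mult using fn by (intro power_mono) auto
  finally have "(real n ^ (d - 1) * real n ^ (2 * d)) * f \<le> f ^ (d - 1) * f"
    by (rule mult_right_mono[OF _ f0])
  moreover have "real n ^ (d - 1) * f * (real n ^ 2) ^ d = (real n ^ (d - 1) * real n ^ (2 * d)) * f"
    by (simp only: power_mult[of "real n" 2 d] mult.assoc mult.commute[of f])
  ultimately have "real n ^ (d - 1) * f * (real n ^ 2) ^ d \<le> f ^ (d - 1) * f" by (simp only:)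
  also have "\<dots> = f ^ d" using d by (simp flip: power_Suc2)
  finally have "real n ^ (d - 1) * f \<le> (f / real n ^ 2) ^ d"
    using d by (simp add: power_divide pos_le_divide_eq)
  hence "norm (maj_sum z n l) ^ d \<le> (f / real n ^ 2) ^ d" using 1 by simp
  thus ?thesis using d f0 power_le_imp_le_base[of "norm (maj_sum z n l)" "d - 1" "f / real n ^ 2"]
    by (simp add: f_def)
qed

lemma root_order_exists:
  assumes "z ^ n = 1" "n > 0"
  obtains d where "root_order z d" "d dvd n"
proof -
  define d where "d = (LEAST m. m > 0 \<and> z ^ m = 1)"
  have d: "d > 0" "z ^ d = 1" using LeastI[of "\<lambda>m. m > 0 \<and> z ^ m = 1" n] assms by (auto simp: d_def)
  have least: "d \<le> m" if "m > 0" "z ^ m = 1" for m using that by (auto simp: d_def intro: Least_le)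
  have "z ^ m = 1 \<longleftrightarrow> d dvd m" for m
  proof
    assume m: "z ^ m = 1"
    have "z ^ m = (z ^ d) ^ (m div d) * z ^ (m mod d)"
      by (simp flip: power_mult power_add)
    hence "z ^ (m mod d) = 1" using m d by simp
    hence "m mod d = 0" using least[of "m mod d"] mod_less_divisor[OF d(1), of m] by (cases "m mod d = 0") auto
    thus "d dvd m" by (simp add: dvd_eq_mod_eq_0)
  next
    assume "d dvd m"
    thus "z ^ m = 1" using d by (auto simp: power_mult)
  qed
  moreover have "norm z = 1"
  proof -
    have "norm z ^ n = 1" using assms(1) by (simp flip: norm_power)
    thus ?thesis using assms(2) power_eq_imp_eq_base[of "norm z" n 1] by simp
  qed
  ultimately have "root_order z d" using d by (simp add: root_order_def)
  moreover from this have "d dvd n" using assms(1) by (simp add: root_order_def)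
  ultimately show ?thesis by (rule that)
qed

text \<open>
  Averaging over the roots of unity. The root 1 gives the main term, and the other \<open>n - 1\<close> roots together at most
  \<open>(n - 1) / n\<close> of the permitted error.
\<close>
lemma word_maj_equidistribution:
  assumes l: "bounded_shape n n l" and n: "n > 0" and f: "card (lattice_words n l) \<ge> n ^ 5"
  shows "\<bar>real (card {w \<in> lattice_words n l. [int (word_maj w) = r] (mod int n)}) / real (card (lattice_words n l)) - 1 / real n\<bar>
         < 1 / (real n)\<^sup>2"
proof -
  define W where "W = lattice_words n l"
  define A where "A = {w\<in>W. [int (word_maj w) = r] (mod int n)}"
  define z where "z = cis (2 * pi / real n)"
  \<comment> \<open>A natural number congruent to \<open>- r\<close>, as exponents of complex numbers are natural.\<close>
  define s where "s = n - nat (r mod int n)"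
  have fin: "finite W" unfolding W_def by (rule finite_lattice_words[OF l])
  have zj: "z ^ j = cis (2 * pi * real j / real n)" for j
    by (simp add: z_def DeMoivre mult_ac)
  have zn: "z ^ n = 1" using n by (simp add: zj)
  have inj: "inj_on (\<lambda>j. z ^ j) {..<n}"
    using bij_betw_roots_unity[OF n] by (simp add: bij_betw_def zj)
  have z1: "z ^ j \<noteq> 1" if "0 < j" "j < n" for j
    using inj_onD[OF inj, of j 0] that by auto
  have z_dvd: "z ^ m = 1 \<longleftrightarrow> n dvd m" for m
  proof -
    have "z ^ m = (z ^ n) ^ (m div n) * z ^ (m mod n)" by (simp flip: power_mult power_add)
    hence "z ^ m = z ^ (m mod n)" by (simp add: zn)
    thus ?thesis using z1[of "m mod n"] n by (cases "m mod n = 0") (auto simp: dvd_eq_mod_eq_0)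
  qed
  have cong: "[int m = r] (mod int n) \<longleftrightarrow> n dvd m + s" for m
  proof -
    have s: "int s = int n - r mod int n" using n by (simp add: s_def of_nat_diff nat_le_iff less_imp_le)
    have "n dvd m + s \<longleftrightarrow> int n dvd int m + int s" by (simp flip: of_nat_add)
    also have "int m + int s = (int m - r mod int n) + int n" by (simp add: s)
    also have "int n dvd \<dots> \<longleftrightarrow> int n dvd int m - r mod int n" by (rule dvd_add_left_iff) simp
    also have "\<dots> \<longleftrightarrow> [int m = r mod int n] (mod int n)" by (simp add: cong_iff_dvd_diff)
    also have "\<dots> \<longleftrightarrow> [int m = r] (mod int n)" by (simp add: cong_def)
    finally show ?thesis by simp
  qed
  have filter: "(\<Sum>j<n. (z ^ j) ^ m) = (if n dvd m then of_nat n else 0)" for m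
  proof (cases "n dvd m")
    case True
    hence "(z ^ j) ^ m = 1" for j using z_dvd by (simp flip: power_mult)
    thus ?thesis using True by simp
  next
    case False
    hence "z ^ m \<noteq> 1" using z_dvd by simp
    have "(\<Sum>j<n. (z ^ j) ^ m) = (\<Sum>j<n. (z ^ m) ^ j)" by (simp add: mult.commute flip: power_mult)
    also have "\<dots> = ((z ^ m) ^ n - 1) / (z ^ m - 1)" using \<open>z ^ m \<noteq> 1\<close> by (rule geometric_sum)
    also have "(z ^ m) ^ n = 1" using z_dvd by (simp flip: power_mult)
    finally show ?thesis using False by simp
  qed
  have "of_nat (card A) * of_nat n = (\<Sum>w\<in>W. if [int (word_maj w) = r] (mod int n) then of_nat n else (0 :: complex))"
    using fin by (simp add: A_def sum.If_cases Int_def)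
  also have "\<dots> = (\<Sum>w\<in>W. \<Sum>j<n. (z ^ j) ^ (word_maj w + s))"
    by (simp add: filter cong)
  also have "\<dots> = (\<Sum>j<n. \<Sum>w\<in>W. (z ^ j) ^ (word_maj w + s))" by (rule sum.swap)
  also have "\<dots> = (\<Sum>j<n. (z ^ j) ^ s * maj_sum (z ^ j) n l)"
    by (simp add: maj_sum_def W_def power_add sum_distrib_left mult_ac)
  also have "\<dots> = of_nat (card W) + (\<Sum>j\<in>{1..<n}. (z ^ j) ^ s * maj_sum (z ^ j) n l)"
  proof -
    have "{..<n} = insert 0 {1..<n}" using n by auto
    thus ?thesis by (simp add: W_def maj_sum_def)
  qed
  finally have "norm (of_nat (card A) * of_nat n - of_nat (card W) :: complex) =
      norm (\<Sum>j\<in>{1..<n}. (z ^ j) ^ s * maj_sum (z ^ j) n l)" by simp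
  also have "\<dots> \<le> (\<Sum>j\<in>{1..<n}. real (card W) / real n ^ 2)"
  proof (rule sum_norm_le)
    fix j assume j: "j \<in> {1..<n}"
    have "(z ^ j) ^ n = 1" using z_dvd by (simp flip: power_mult)
    then obtain d where d: "root_order (z ^ j) d" "d dvd n" using n by (rule root_order_exists)
    have "d \<noteq> 1" using d(1) z1[of j] j unfolding root_order_def by (metis atLeastLessThan_iff less_le_trans one_dvd power_one_right zero_less_one)
    moreover have "d > 0" using d by (simp add: root_order_def)
    ultimately have "norm (maj_sum (z ^ j) n l) \<le> real (card W) / real n ^ 2"
      unfolding W_def by (intro norm_maj_sum_root_le[OF d(1) _ d(2) n l f]) simp
    moreover have "norm (z ^ j) = 1" using d by (simp add: root_order_def)
    ultimately show "norm ((z ^ j) ^ s * maj_sum (z ^ j) n l) \<le> real (card W) / real n ^ 2"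
      by (simp add: norm_mult norm_power)
  qed
  also have "\<dots> = (real n - 1) * real (card W) / real n ^ 2" using n by (simp add: of_nat_diff)
  also have "of_nat (card A) * of_nat n - of_nat (card W) = (of_real (real (card A) * real n - real (card W)) :: complex)"
    by simp
  finally have bound: "\<bar>real (card A) * real n - real (card W)\<bar> \<le> (real n - 1) * real (card W) / real n ^ 2"
    by (simp only: norm_of_real)
  have W0: "real (card W) > 0" using f n unfolding W_def by (metis gr_zeroI le_zero_eq of_nat_0_less_iff power_eq_0_iff)
  have "real (card A) / real (card W) - 1 / real n = (real (card A) * real n - real (card W)) / (real (card W) * real n)"
    using W0 n by (simp add: field_simps)
  hence "\<bar>real (card A) / real (card W) - 1 / real n\<bar> = \<bar>real (card A) * real n - real (card W)\<bar> / (real (card W) * real n)"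
    using W0 n by (simp add: abs_mult)
  also have "\<dots> \<le> ((real n - 1) * real (card W) / real n ^ 2) / (real (card W) * real n)"
    using bound by (rule divide_right_mono) simp
  also have "\<dots> = (real n - 1) / real n / real n ^ 2" using W0 n by simp
  also have "\<dots> < 1 / real n ^ 2" using n by (intro divide_strict_right_mono) auto
  finally show ?thesis by (simp add: A_def W_def)
qed

section \<open>Counting lattice words by branching\<close>

declare lattice_words.simps(2) [simp del]

definition height :: "(nat \<Rightarrow> nat) \<Rightarrow> nat" where
  "height l = card {i. l i > 0}"

text \<open>
  Shapes with few tableaux are those with a long first row or a long first column; the level \<open>j\<close> measures
  how far a shape of size \<open>n\<close> is from both.
\<close>
definition deep :: "nat \<Rightarrow> nat \<Rightarrow> (nat \<Rightarrow> nat) \<Rightarrow> bool" where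
  "deep j n l \<longleftrightarrow> l 0 + j \<le> n \<and> height l + j \<le> n"

abbreviation remove :: "nat \<Rightarrow> (nat \<Rightarrow> nat) \<Rightarrow> nat \<Rightarrow> nat" where
  "remove r l \<equiv> l(r := l r - 1)"

abbreviation num_words :: "nat \<Rightarrow> (nat \<Rightarrow> nat) \<Rightarrow> nat" where
  "num_words n l \<equiv> card (lattice_words n l)"

lemma num_words_Suc:
  assumes "bounded_shape k (Suc n) l"
  shows "num_words (Suc n) l = (\<Sum>r\<in>corners l. num_words n (remove r l))"
  using sum_lattice_words_Suc[OF assms, of "\<lambda>_. 1 :: nat"] by simp

lemma height_bounds:
  assumes l: "bounded_shape k n l"
  shows "{i. l i > 0} = {..<height l}" "height l \<le> k"
proof -
  have anti: "antimono l" and z: "\<And>i. k \<le> i \<Longrightarrow> l i = 0" using l by (auto simp: bounded_shape_def)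
  define h where "h = (LEAST i. l i = 0)"
  have h: "l h = 0" "h \<le> k"
    unfolding h_def using LeastI[of "\<lambda>i. l i = 0" k] Least_le[of "\<lambda>i. l i = 0" k] z[of k] by simp_all
  have "l i > 0 \<longleftrightarrow> i < h" for i
  proof
    assume "l i > 0"
    thus "i < h" using antimonoD[OF anti, of h i] h(1) by (cases "i < h") auto
  next
    assume "i < h"
    thus "l i > 0" using not_less_Least[of i "\<lambda>i. l i = 0"] by (simp add: h_def)
  qed
  hence eq: "{i. l i > 0} = {..<h}" by auto
  thus "{i. l i > 0} = {..<height l}" "height l \<le> k" using h(2) by (auto simp: height_def)
qed

lemma sum_rows:
  assumes l: "bounded_shape k n l"
  shows "(\<Sum>i<height l. l i) = n"
proof -
  have pos: "l i > 0 \<longleftrightarrow> i < height l" for i using height_bounds(1)[OF l] by auto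
  have "(\<Sum>i<height l. l i) = (\<Sum>i<k. l i)"
  proof (rule sum.mono_neutral_left)
    show "\<forall>i\<in>{..<k} - {..<height l}. l i = 0"
    proof
      fix i assume "i \<in> {..<k} - {..<height l}"
      thus "l i = 0" using pos[of i] by simp
    qed
  qed (use height_bounds(2)[OF l] in auto)
  thus ?thesis using l by (simp add: bounded_shape_def)
qed

lemma corner_with_value:
  assumes l: "bounded_shape k n l" and i: "l i > 0"
  obtains s where "s \<in> corners l" "l s = l i"
proof -
  have anti: "antimono l" using l by (simp add: bounded_shape_def)
  have pos: "l i > 0 \<longleftrightarrow> i < height l" for i using height_bounds(1)[OF l] by auto
  define S where "S = {s. l s = l i}"
  have "S \<subseteq> {..<height l}"
  proof
    fix s assume "s \<in> S"
    thus "s \<in> {..<height l}" using i pos[of s] by (simp add: S_def)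
  qed
  hence fin: "finite S" by (rule finite_subset) simp
  have "Max S \<in> S" by (rule Max_in[OF fin]) (auto simp: S_def)
  hence 1: "l (Max S) = l i" by (simp add: S_def)
  have "l (Suc (Max S)) \<noteq> l i"
  proof
    assume "l (Suc (Max S)) = l i"
    hence "Suc (Max S) \<le> Max S" by (intro Max_ge[OF fin]) (simp add: S_def)
    thus False by simp
  qed
  hence "Max S \<in> corners l" using 1 antimonoD[OF anti, of "Max S" "Suc (Max S)"] by (simp add: corners_def)
  thus ?thesis using 1 by (rule that)
qed

lemma num_words_pos:
  assumes "bounded_shape k n l"
  shows "num_words n l \<ge> 1"
  using assms
proof (induction n arbitrary: l)
  case (Suc n)
  have "\<exists>i. l i > 0"
  proof (rule ccontr)
    assume "\<not> (\<exists>i. l i > 0)"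
    hence "(\<Sum>i<height l. l i) = 0" by simp
    thus False using sum_rows[OF Suc.prems] by simp
  qed
  then obtain i where "l i > 0" by blast
  then obtain r where r: "r \<in> corners l" by (rule corner_with_value[OF Suc.prems])
  have le: "num_words n (remove r l) \<le> num_words (Suc n) l"
    unfolding num_words_Suc[OF Suc.prems]
    by (rule member_le_sum[OF r]) (use finite_corners[OF Suc.prems] in auto)
  show ?case by (rule order_trans[OF Suc.IH[OF bounded_shape_remove[OF Suc.prems r]] le])
qed simp

lemma num_words_two_corners:
  assumes l: "bounded_shape k (Suc n) l" and st: "s \<in> corners l" "t \<in> corners l" "s \<noteq> t"
  shows "num_words n (remove s l) + num_words n (remove t l) \<le> num_words (Suc n) l"
proof -
  have "(\<Sum>r\<in>{s, t}. num_words n (remove r l)) \<le> (\<Sum>r\<in>corners l. num_words n (remove r l))"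
    using st finite_corners[OF l] by (intro sum_mono2) auto
  thus ?thesis using st by (simp add: num_words_Suc[OF l])
qed

lemma height_remove:
  assumes l: "bounded_shape k n l"
  shows "height (remove r l) \<le> height l" "r \<in> corners l \<Longrightarrow> l r = 1 \<Longrightarrow> Suc (height (remove r l)) = height l"
proof -
  have fin: "finite {i. l i > 0}" using height_bounds[OF l] by simp
  show "height (remove r l) \<le> height l"
    unfolding height_def by (rule card_mono[OF fin]) (auto split: if_splits)
  assume r: "r \<in> corners l" "l r = 1"
  have eq: "{i. remove r l i > 0} = {i. l i > 0} - {r}" using r by auto
  show "Suc (height (remove r l)) = height l"
    unfolding height_def eq by (rule card_Suc_Diff1[OF fin]) (simp add: r(2))
qed

lemma deep_remove:
  assumes l: "bounded_shape k (Suc n) l" and "deep (Suc j) (Suc n) l"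
  shows "deep j n (remove r l)"
  using assms(2) height_remove(1)[OF l, of r] by (auto simp: deep_def)

text \<open>
  The first row and the first column share one cell, and the first two rows are disjoint.
\<close>
lemma excess_rows:
  assumes l: "bounded_shape k n l" and h: "height l > 0"
  shows "l 0 + height l \<le> n + 1" "height l \<ge> 2 \<Longrightarrow> l 0 + l 1 \<le> n"
proof -
  have pos: "l i > 0 \<longleftrightarrow> i < height l" for i using height_bounds(1)[OF l] by auto
  have "n = l 0 + (\<Sum>i\<in>{..<height l} - {0}. l i)"
    using sum_rows[OF l] h by (subst sum.remove[symmetric]) auto
  moreover have "(\<Sum>i\<in>{..<height l} - {0}. 1) \<le> (\<Sum>i\<in>{..<height l} - {0}. l i)"
    using pos by (intro sum_mono) (auto simp: Suc_le_eq)
  ultimately show "l 0 + height l \<le> n + 1" using h by simp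
  assume "height l \<ge> 2"
  hence "(\<Sum>i\<in>{0, 1}. l i) \<le> (\<Sum>i<height l. l i)" by (intro sum_mono2) auto
  thus "l 0 + l 1 \<le> n" using sum_rows[OF l] by simp
qed

text \<open>
  Removing any cell lowers the level by at most 1. If the level exceeds \<open>j\<close>, any two corners do. Otherwise
  the first row or the first column misses exactly \<open>j\<close> cells; as \<open>n\<close> is large this line is longer
  than its neighbour, so that its end is a corner, whose removal keeps the level, and a second
  corner exists because \<open>j \<ge> 1\<close>.
\<close>
lemma two_children:
  assumes l: "bounded_shape k (Suc n) l" and j: "j \<ge> 1" "2 * j + 2 \<le> Suc n" and deep: "deep j (Suc n) l"
    and two: "\<not> (\<exists>r. corners l \<subseteq> {r})"
  obtains s t where "s \<in> corners l" "t \<in> corners l" "s \<noteq> t" "deep j n (remove s l)" "deep (j - 1) n (remove t l)"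
proof -
  have anti: "antimono l" using l by (simp add: bounded_shape_def)
  have pos: "l i > 0 \<longleftrightarrow> i < height l" for i using height_bounds(1)[OF l] by auto
  have h0: "height l > 0" using sum_rows[OF l] by (cases "height l") auto
  have l0: "l 0 > 0" using pos h0 by simp
  \<comment> \<open>Any removal is good enough for the second corner.\<close>
  have child: "deep (j - 1) n (remove t l)" for t
    using deep_remove[OF l, of "j - 1"] deep j by simp
  show ?thesis
  proof (cases "deep (Suc j) (Suc n) l")
    case True
    obtain s t where "s \<in> corners l" "t \<in> corners l" "s \<noteq> t" using two by blast
    thus ?thesis by (rule that[OF _ _ _ deep_remove[OF l True] child])
  next
    case False
    hence "l 0 + j = Suc n \<or> height l + j = Suc n" using deep by (auto simp: deep_def)
    thus ?thesis
    proof
      assume e: "l 0 + j = Suc n"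
      have h2: "height l \<ge> 2"
      proof (rule ccontr)
        assume "\<not> height l \<ge> 2"
        hence "height l = 1" using h0 by simp
        thus False using sum_rows[OF l] e j by simp
      qed
      have "l 1 < l 0" using excess_rows(2)[OF l h0 h2] e j by simp
      hence c0: "0 \<in> corners l" by (simp add: corners_def)
      obtain t where t: "t \<in> corners l" "l t = l 1"
        by (rule corner_with_value[OF l, of 1]) (use pos h2 in simp)
      have ne: "0 \<noteq> t" using t \<open>l 1 < l 0\<close> by (cases "t = 0") auto
      have "deep j n (remove 0 l)"
        using e j l0 excess_rows(1)[OF l h0] height_remove(1)[OF l, of 0] by (simp add: deep_def)
      thus ?thesis by (rule that[OF c0 t(1) ne _ child])
    next
      assume e: "height l + j = Suc n"
      have 1: "l (height l - 1) = 1"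
      proof (rule ccontr)
        assume "l (height l - 1) \<noteq> 1"
        hence two: "l (height l - 1) \<ge> 2" using pos[of "height l - 1"] h0 by simp
        have "2 \<le> l i" if "i < height l" for i
          using that by (intro order_trans[OF two] antimonoD[OF anti]) simp
        hence "(\<Sum>i<height l. 2) \<le> (\<Sum>i<height l. l i)" by (intro sum_mono) auto
        thus False using sum_rows[OF l] e j by simp
      qed
      have "l 0 \<ge> 2"
      proof (rule ccontr)
        assume "\<not> l 0 \<ge> 2"
        hence "l i \<le> 1" for i using antimonoD[OF anti, of 0 i] by simp
        hence "(\<Sum>i<height l. l i) \<le> (\<Sum>i<height l. 1)" by (intro sum_mono) auto
        thus False using sum_rows[OF l] e j by simp
      qed
      have "l (height l - 1) > 0" using 1 by simp
      then obtain s where "s \<in> corners l" "l s = l (height l - 1)" by (rule corner_with_value[OF l])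
      hence s: "s \<in> corners l" "l s = 1" using 1 by (simp_all only:)
      obtain t where t: "t \<in> corners l" "l t = l 0" by (rule corner_with_value[OF l l0])
      have ne: "s \<noteq> t" using s t \<open>l 0 \<ge> 2\<close> by auto
      have "deep j n (remove s l)"
        using e j excess_rows(1)[OF l h0] height_remove(2)[OF l s] by (auto simp: deep_def)
      thus ?thesis by (rule that[OF s(1) t(1) ne _ child])
    qed
  qed
qed

text \<open>
  A shape with a single corner is a rectangle. Here it has at least two rows and two columns, so
  the first row and the first column each have at most half of the cells;
  after the loss of the corner there are two new corners.
\<close>
lemma rectangle_grandchildren:
  assumes l: "bounded_shape k (Suc (Suc n)) l" and deep: "deep 1 (Suc (Suc n)) l" and one: "corners l \<subseteq> {r}"
  obtains s t where "r \<in> corners l" "s \<in> corners (remove r l)" "t \<in> corners (remove r l)" "s \<noteq> t"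
    "\<And>j s. 2 * j + 4 \<le> Suc (Suc n) \<Longrightarrow> deep j n (remove s (remove r l))"
proof -
  have anti: "antimono l" using l by (simp add: bounded_shape_def)
  have pos: "l i > 0 \<longleftrightarrow> i < height l" for i using height_bounds(1)[OF l] by auto
  have h0: "height l > 0" using sum_rows[OF l] by (cases "height l") auto
  have const: "l i = l 0" if i: "i < height l" for i
  proof -
    obtain s where s: "s \<in> corners l" "l s = l i"
      by (rule corner_with_value[OF l, of i]) (use pos i in simp)
    obtain t where t: "t \<in> corners l" "l t = l 0"
      by (rule corner_with_value[OF l, of 0]) (use pos h0 in simp)
    have "s = r" "t = r" using one s(1) t(1) by auto
    thus ?thesis using s(2) t(2) by simp
  qed
  have area: "height l * l 0 = Suc (Suc n)"
  proof -
    have "(\<Sum>i<height l. l i) = (\<Sum>i<height l. l 0)" by (rule sum.cong[OF refl]) (rule const, simp)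
    thus ?thesis using sum_rows[OF l] by simp
  qed
  have h2: "height l \<ge> 2"
  proof (rule ccontr)
    assume "\<not> height l \<ge> 2"
    hence "height l = 1" using h0 by simp
    thus False using area deep by (simp add: deep_def)
  qed
  have b2: "l 0 \<ge> 2"
  proof (rule ccontr)
    assume "\<not> l 0 \<ge> 2"
    hence "l 0 = 1" using pos[of 0] h0 by simp
    thus False using area deep by (simp add: deep_def)
  qed
  \<comment> \<open>After the corner in the last row is removed, the new corners are the last two rows.\<close>
  define h where "h = height l - 2"
  have h: "height l = Suc (Suc h)" using h2 by (simp add: h_def)
  have last: "l (Suc h) = l 0" "l h = l 0" "l (Suc (Suc h)) = 0"
    using const[of "Suc h"] const[of h] h pos[of "Suc (Suc h)"] by simp_all
  have "Suc h \<in> corners l" using last b2 by (simp add: corners_def)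
  hence r: "r = Suc h" using one by auto
  have c: "Suc h \<in> corners (remove r l)" "h \<in> corners (remove r l)"
    using last b2 by (simp_all add: corners_def r)
  have d: "deep j n (remove s (remove r l))" if "2 * j + 4 \<le> Suc (Suc n)" for j s
  proof -
    have "2 * l 0 \<le> height l * l 0" "height l * 2 \<le> height l * l 0" using h2 b2 by simp_all
    hence "deep (Suc (Suc j)) (Suc (Suc n)) l" using that area by (simp add: deep_def)
    hence deep1: "deep (Suc j) (Suc n) (remove r l)" by (rule deep_remove[OF l])
    have l1: "bounded_shape k (Suc n) (remove r l)"
      by (rule bounded_shape_remove[OF l]) (use \<open>Suc h \<in> corners l\<close> r in simp)
    show ?thesis by (rule deep_remove[OF l1 deep1])
  qed
  have "r \<in> corners l" using \<open>Suc h \<in> corners l\<close> r by simp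
  thus ?thesis by (rule that[OF _ c _ d]) simp
qed

lemma num_words_branching:
  assumes l: "bounded_shape k (Suc (Suc n)) l" and j: "j \<ge> 1" "2 * j + 2 \<le> Suc (Suc n)" and deep: "deep j (Suc (Suc n)) l"
    and one: "\<And>i l'. i \<in> {j - 1, j} \<Longrightarrow> bounded_shape k (Suc n) l' \<Longrightarrow> deep i (Suc n) l' \<Longrightarrow> b i \<le> num_words (Suc n) l'"
    and two: "\<And>l'. bounded_shape k n l' \<Longrightarrow> (\<And>i. 2 * i + 4 \<le> Suc (Suc n) \<Longrightarrow> deep i n l') \<Longrightarrow> c \<le> num_words n l'"
  shows "min (b j + b (j - 1)) (2 * c) \<le> num_words (Suc (Suc n)) l"
proof (cases "\<exists>r. corners l \<subseteq> {r}")
  case False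
  then obtain s t where st: "s \<in> corners l" "t \<in> corners l" "s \<noteq> t" "deep j (Suc n) (remove s l)" "deep (j - 1) (Suc n) (remove t l)"
    by (rule two_children[OF l j deep])
  have "b j \<le> num_words (Suc n) (remove s l)"
    by (rule one[OF _ bounded_shape_remove[OF l st(1)] st(4)]) simp
  moreover have "b (j - 1) \<le> num_words (Suc n) (remove t l)"
    by (rule one[OF _ bounded_shape_remove[OF l st(2)] st(5)]) simp
  ultimately show ?thesis using num_words_two_corners[OF l st(1-3)] by simp
next
  case True
  then obtain r where r: "corners l \<subseteq> {r}" by blast
  have deep1: "deep 1 (Suc (Suc n)) l" using deep j by (auto simp: deep_def)
  obtain s t where
    st: "r \<in> corners l" "s \<in> corners (remove r l)" "t \<in> corners (remove r l)" "s \<noteq> t"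
    "\<And>j s. 2 * j + 4 \<le> Suc (Suc n) \<Longrightarrow> deep j n (remove s (remove r l))"
    by (rule rectangle_grandchildren[OF l deep1 r], rule that)
  note l' = bounded_shape_remove[OF l st(1)]
  have c: "c \<le> num_words n (remove u (remove r l))" if "u \<in> corners (remove r l)" for u
    by (rule two[OF bounded_shape_remove[OF l' that] st(5)])
  have "corners l = {r}" using r st(1) by auto
  hence eq: "num_words (Suc (Suc n)) l = num_words (Suc n) (remove r l)" by (simp add: num_words_Suc[OF l])
  have "2 * c \<le> num_words (Suc n) (remove r l)"
    using num_words_two_corners[OF l' st(2-4)] c[OF st(2)] c[OF st(3)] by linarith
  thus ?thesis unfolding eq by (rule min.coboundedI2)
qed

text \<open>
  Levels above 8 are not distinguished; 8 is the level of the shapes in the theorem.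
\<close>
definition level_bound :: "nat \<Rightarrow> nat \<Rightarrow> (nat \<Rightarrow> nat) \<Rightarrow> bool" where
  "level_bound k n b \<longleftrightarrow> (\<forall>l j. bounded_shape k n l \<longrightarrow> j \<le> 8 \<longrightarrow> deep j n l \<longrightarrow> b j \<le> num_words n l)"

lemma level_bound_step:
  assumes n: "n \<ge> 18" and cur: "level_bound k (Suc n) b" and prev: "level_bound k n c"
    and d: "d 0 \<le> 1" "\<And>j. 1 \<le> j \<Longrightarrow> j \<le> 8 \<Longrightarrow> d j \<le> b j + b (j - 1) \<and> d j \<le> 2 * c 8"
  shows "level_bound k (Suc (Suc n)) d"
  unfolding level_bound_def
proof (intro allI impI)
  fix l j assume l: "bounded_shape k (Suc (Suc n)) l" and j: "j \<le> 8" and deep: "deep j (Suc (Suc n)) l"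
  show "d j \<le> num_words (Suc (Suc n)) l"
  proof (cases "j = 0")
    case True
    thus ?thesis using d(1) num_words_pos[OF l] by simp
  next
    case False
    hence j1: "j \<ge> 1" by simp
    have "min (b j + b (j - 1)) (2 * c 8) \<le> num_words (Suc (Suc n)) l"
    proof (rule num_words_branching[OF l j1 _ deep])
      show "2 * j + 2 \<le> Suc (Suc n)" using j n by simp
      show "b i \<le> num_words (Suc n) l'" if "i \<in> {j - 1, j}" "bounded_shape k (Suc n) l'" "deep i (Suc n) l'" for i l'
        using cur that j unfolding level_bound_def by auto
      show "c 8 \<le> num_words n l'" if "bounded_shape k n l'" "\<And>i. 2 * i + 4 \<le> Suc (Suc n) \<Longrightarrow> deep i n l'" for l'
        using prev that(1) that(2)[of 8] n unfolding level_bound_def by auto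
    qed
    moreover have "d j \<le> min (b j + b (j - 1)) (2 * c 8)" using d(2)[OF j1 j] by simp
    ultimately show ?thesis by (rule order_trans[rotated])
  qed
qed

text \<open>
  A first bound for the shapes that are neither a row nor a column, to start the recurrence of
  levels with. The rectangles double a bound for \<open>n - 2\<close>, the other shapes gain at least 1.
\<close>
lemma num_words_ge_half:
  assumes "bounded_shape k n l" "deep 1 n l"
  shows "n div 2 - 1 \<le> num_words n l"
  using assms
proof (induction n arbitrary: l rule: less_induct)
  case (less n)
  show ?case
  proof (cases "n < 6")
    case True
    thus ?thesis using num_words_pos[OF less.prems(1)] by linarith
  next
    case False
    define m where "m = n - 2"
    have m: "n = Suc (Suc m)" "m \<ge> 4" using False by (simp_all add: m_def)
    define b where "b i = (if i = 0 then 1 else Suc m div 2 - 1)" for i :: nat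
    have le: "min (b 1 + b (1 - 1)) (2 * (m div 2 - 1)) \<le> num_words (Suc (Suc m)) l"
    proof (rule num_words_branching)
      show "bounded_shape k (Suc (Suc m)) l" "deep 1 (Suc (Suc m)) l" using less.prems m by auto
      show "b i \<le> num_words (Suc m) l'" if "i \<in> {1 - 1, 1}" "bounded_shape k (Suc m) l'" "deep i (Suc m) l'" for i l'
        using that less.IH[of "Suc m" l'] num_words_pos[OF that(2)] m by (auto simp: b_def)
      show "m div 2 - 1 \<le> num_words m l'" if "bounded_shape k m l'" "\<And>i. 2 * i + 4 \<le> Suc (Suc m) \<Longrightarrow> deep i m l'" for l'
        using that(1) that(2)[of 1] less.IH[of m l'] m by auto
    qed (use m in auto)
    have "n div 2 - 1 \<le> min (b 1 + b (1 - 1)) (2 * (m div 2 - 1))" using m by (auto simp: b_def)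
    from order_trans[OF this le] show ?thesis unfolding m(1) .
  qed
qed

text \<open>
  Entry \<open>j\<close> of a row is the lower bound for level \<open>j\<close>; from the rows of \<open>n\<close> and \<open>n + 1\<close> the row of \<open>n + 2\<close> results.
  The last entry \<open>last p\<close> is a bound for what a rectangle leaves after two removals.
\<close>
definition next_row :: "nat list \<Rightarrow> nat list \<Rightarrow> nat list" where
  "next_row p c = 1 # map2 (\<lambda>x y. min (x + y) (2 * last p)) (tl c) c"

fun row_after :: "nat \<Rightarrow> nat list \<Rightarrow> nat list \<Rightarrow> nat list" where
  "row_after 0 p c = c"
| "row_after (Suc m) p c = row_after m c (next_row p c)"

text \<open>
  An explicit form that the simplifier can evaluate numerically.
\<close>
lemma next_row_eq:
  "next_row [a0,a1,a2,a3,a4,a5,a6,a7,a8] [b0,b1,b2,b3,b4,b5,b6,b7,b8] =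
   [1, min (b1+b0) (2*a8), min (b2+b1) (2*a8), min (b3+b2) (2*a8), min (b4+b3) (2*a8),
    min (b5+b4) (2*a8), min (b6+b5) (2*a8), min (b7+b6) (2*a8), min (b8+b7) (2*a8)]"
  by (simp add: next_row_def)

lemma row_after_numeral:
  "row_after (numeral v) p c = row_after (pred_numeral v) c (next_row p c)"
  by (simp add: numeral_eq_Suc)

lemma next_row_nth:
  assumes "length p = 9" "length c = 9"
  shows "length (next_row p c) = 9" "next_row p c ! 0 = 1"
    "1 \<le> j \<Longrightarrow> j \<le> 8 \<Longrightarrow> next_row p c ! j = min (c ! j + c ! (j - 1)) (2 * p ! 8)"
proof -
  show "length (next_row p c) = 9" "next_row p c ! 0 = 1" using assms by (simp_all add: next_row_def)
  assume j: "1 \<le> j" "j \<le> 8"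
  then obtain i where i: "j = Suc i" by (cases j) auto
  have "last p = p ! 8" using assms(1) by (subst last_conv_nth) auto
  thus "next_row p c ! j = min (c ! j + c ! (j - 1)) (2 * p ! 8)"
    using assms j by (simp add: next_row_def i nth_tl)
qed

lemma level_bound_row_after:
  assumes "level_bound k n (nth p)" "level_bound k (Suc n) (nth c)" "n \<ge> 18" "length p = 9" "length c = 9"
  shows "level_bound k (Suc n + m) (nth (row_after m p c))"
  using assms
proof (induction m arbitrary: n p c)
  case (Suc m)
  note nr = next_row_nth[OF Suc.prems(4,5)]
  have "level_bound k (Suc (Suc n)) (nth (next_row p c))"
    by (rule level_bound_step[OF Suc.prems(3,2,1)]) (simp_all add: nr)
  from Suc.IH[OF Suc.prems(2) this _ Suc.prems(5) nr(1)] Suc.prems(3)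
  show ?case by simp
qed simp

text \<open>
  Starting from \<open>n ^ 5\<close> for level 8, each entry is a monomial large enough to dominate the difference of
  its successor: \<open>(n + 1) ^ 5 - n ^ 5 \<le> 6 * n ^ 4\<close> for \<open>n \<ge> 81\<close>, and so on downwards. From level 3 on
  downwards constants suffice.
\<close>
definition poly_row :: "nat \<Rightarrow> nat list" where
  "poly_row n = [1, 1, 1, 156, 156 * n, 77 * n ^ 2, 25 * n ^ 3, 6 * n ^ 4, n ^ 5]"

text \<open>
  Both inequalities compare polynomials in \<open>n - 81\<close> coefficient by coefficient.
\<close>
lemma poly_row_step:
  assumes "n \<ge> 81" "1 \<le> j" "j \<le> 8"
  shows "poly_row (Suc (Suc n)) ! j \<le> poly_row (Suc n) ! j + poly_row (Suc n) ! (j - 1)"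
    "poly_row (Suc (Suc n)) ! j \<le> 2 * poly_row n ! 8"
proof -
  define x where "x = n - 81"
  have n: "n = x + 81" "Suc n = x + 82" "Suc (Suc n) = x + 83" using assms(1) by (simp_all add: x_def)
  have j: "j = 1 \<or> j = 2 \<or> j = 3 \<or> j = 4 \<or> j = 5 \<or> j = 6 \<or> j = 7 \<or> j = 8" using assms by auto
  have pow: "y ^ 2 = y * y" "y ^ 3 = y * y * y" "y ^ 4 = y * y * y * y" "y ^ 5 = y * y * y * y * y" for y :: nat
    by (simp_all add: power_numeral_reduce)
  show "poly_row (Suc (Suc n)) ! j \<le> poly_row (Suc n) ! j + poly_row (Suc n) ! (j - 1)"
    unfolding n using j by (elim disjE) (simp_all add: poly_row_def pow algebra_simps)
  show "poly_row (Suc (Suc n)) ! j \<le> 2 * poly_row n ! 8"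
    unfolding n using j by (elim disjE) (simp_all add: poly_row_def pow algebra_simps)
qed

lemma num_words_ge_power5:
  assumes l: "bounded_shape k n l" and n: "n \<ge> 81" and deep: "deep 8 n l"
  shows "n ^ 5 \<le> num_words n l"
proof -
  \<comment> \<open>By \<open>num_words_ge_half\<close> this row is valid for \<open>n = 18\<close> and for \<open>n = 19\<close>, so \<open>row_after m\<close> is valid for \<open>n = 19 + m\<close>.\<close>
  define p where "p = [1 :: nat, 8, 8, 8, 8, 8, 8, 8, 8]"
  have nth_p: "p ! j \<le> 8" "p ! 0 = 1" if "j \<le> 8" for j
    using that by (auto simp: p_def nth_Cons')
  have start: "level_bound k m (nth p)" if "m \<in> {18, 19}" for m
    unfolding level_bound_def
  proof (intro allI impI)
    fix l j assume l: "bounded_shape k m l" and j: "j \<le> 8" and deep: "deep j m l"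
    show "p ! j \<le> num_words m l"
    proof (cases "j = 0")
      case True
      thus ?thesis using num_words_pos[OF l] nth_p[of 0] by simp
    next
      case False
      hence "deep 1 m l" using deep by (auto simp: deep_def)
      from num_words_ge_half[OF l this] have "8 \<le> num_words m l" using that by auto
      thus ?thesis using nth_p(1)[OF j] by simp
    qed
  qed
  have row: "level_bound k (19 + m) (nth (row_after m p p))" for m
    using level_bound_row_after[of k 18 p p m] start[of 18] start[of 19] by (simp add: p_def)
  have poly: "level_bound k m (nth (poly_row m))" if "level_bound k m (nth r)" "\<forall>j\<le>8. poly_row m ! j \<le> r ! j" for m r
    using that unfolding level_bound_def by (meson order_trans)
  have 81: "level_bound k 81 (nth (poly_row 81))"
    using row[of 62] by (intro poly) (auto simp: p_def row_after_numeral next_row_eq poly_row_def nth_Cons')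
  have 82: "level_bound k 82 (nth (poly_row 82))"
    using row[of 63] by (intro poly) (auto simp: p_def row_after_numeral next_row_eq poly_row_def nth_Cons')
  have "level_bound k (81 + m) (nth (poly_row (81 + m))) \<and> level_bound k (82 + m) (nth (poly_row (82 + m)))" for m
  proof (induction m)
    case 0
    show ?case using 81 82 by simp
  next
    case (Suc m)
    have "level_bound k (Suc (Suc (81 + m))) (nth (poly_row (Suc (Suc (81 + m)))))"
      by (rule level_bound_step[of "81 + m" k "nth (poly_row (82 + m))" "nth (poly_row (81 + m))"])
         (use Suc poly_row_step[of "81 + m"] in \<open>auto simp: poly_row_def\<close>)
    thus ?case using Suc by simp
  qed
  from this[of "n - 81"] have "level_bound k n (nth (poly_row n))" using n by simp
  hence "poly_row n ! 8 \<le> num_words n l" using l deep unfolding level_bound_def by blast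
  thus ?thesis by (simp add: poly_row_def)
qed

section \<open>Equidistribution modulo the size of the shape\<close>

theorem theorem7:
  fixes lam :: "nat list" and n :: nat
  assumes "partition_of lam n"
  shows "(num_SYT lam \<ge> n ^ 5 \<and> n ^ 5 \<ge> 1 \<longrightarrow>
           (\<forall>r::int. \<bar>real (num_SYT_maj lam r) / real (num_SYT lam) - 1 / real n\<bar> < 1 / (real n)\<^sup>2))
       \<and> (n \<ge> 81 \<and> nth_part lam 1 < n - 7 \<and> nth_part (conjugate_partition lam) 1 < n - 7 \<longrightarrow>
           num_SYT lam \<ge> n ^ 5 \<and>
           (\<forall>r::int. \<bar>real (num_SYT_maj lam r) / real (num_SYT lam) - 1 / real n\<bar> < 1 / (real n)\<^sup>2))"
proof -
  define l where "l = parts_fun lam"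
  have shape: "bounded_shape (length lam) n l"
    unfolding l_def by (rule bounded_shape_parts_fun(1)[OF assms])
  have l: "bounded_shape n n l"
    by (rule bounded_shape_pad[OF shape bounded_shape_parts_fun(2)[OF assms]])
  have equidistributed: "\<bar>real (num_SYT_maj lam r) / real (num_SYT lam) - 1 / real n\<bar> < 1 / (real n)\<^sup>2"
    if "n > 0" "num_SYT lam \<ge> n ^ 5" for r
    using word_maj_equidistribution[OF l that(1), of r] that(2)
    by (simp add: SYT_word_counts[OF assms] l_def)
  have large: "num_SYT lam \<ge> n ^ 5"
    if n: "n \<ge> 81" and "nth_part lam 1 < n - 7" "nth_part (conjugate_partition lam) 1 < n - 7"
  proof -
    have "l 0 + 8 \<le> n" using that by (simp add: l_def parts_fun_def)
    moreover have "height l + 8 \<le> n"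
      using height_bounds(2)[OF shape] that nth_part_conjugate_1[OF assms] by simp
    ultimately have "deep 8 n l" by (simp add: deep_def)
    from num_words_ge_power5[OF shape n this] show ?thesis
      by (simp add: SYT_word_counts[OF assms] l_def)
  qed
  show ?thesis
  proof (intro conjI impI allI)
    fix r :: int
    assume *: "num_SYT lam \<ge> n ^ 5 \<and> n ^ 5 \<ge> 1"
    hence "n > 0" by (cases n) auto
    thus "\<bar>real (num_SYT_maj lam r) / real (num_SYT lam) - 1 / real n\<bar> < 1 / (real n)\<^sup>2"
      using * equidistributed by blast
  next
    assume "n \<ge> 81 \<and> nth_part lam 1 < n - 7 \<and> nth_part (conjugate_partition lam) 1 < n - 7"
    thus "num_SYT lam \<ge> n ^ 5" using large by blast
  next
    fix r :: int
    assume *: "n \<ge> 81 \<and> nth_part lam 1 < n - 7 \<and> nth_part (conjugate_partition lam) 1 < n - 7"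
    hence "n > 0" "num_SYT lam \<ge> n ^ 5" using large by auto
    thus "\<bar>real (num_SYT_maj lam r) / real (num_SYT lam) - 1 / real n\<bar> < 1 / (real n)\<^sup>2"
      by (rule equidistributed)
  qed
qed

end
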